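(* Let $(X,d_X)$ be a proper, non-compact $\mathrm{CAT}(-1)$ space. The map $$\varphi_{\mathrm{sing}}:\partial_\infty^{\max}(X\times X)_{\mathrm{sing}}\longrightarrow\partial_\infty X\sqcup\partial_\infty X$$ that associates to the class of a Busemann function depending only on the first (respectively second) factor of $X\times X$, i.e. to the class of $(z,z')\mapsto\beta^{o}_{\xi}(z)$ (respectively $(z,z')\mapsto\beta^{o}_{\xi'}(z')$), the same Busemann function viewed as the point $\xi$ in the first (respectively $\xi'$ in the second) copy of $\partial_\infty X$ in $\partial_\infty X\sqcup\partial_\infty X$, is a homeomorphism.
   Context: $o\in X$ is a fixed base point. $\partial_\infty X$ is the ideal boundary of $X$ (equivalence classes of geodesic rays at bounded distance) with its usual topology, equivalently the horofunction boundary of $X$: $\xi$ is identified with the class modulo constants of its Busemann function $\beta_\xi^p(\cdot)=\lim_{t\to\infty}\bigl(d_X(\cdot,c(t))-t\bigr)$, where $c$ is the ray with $c(0)=p$, $c(\infty)=\xi$. On $X\times X$ consider $d_{\max}((x,y),(x',y'))=\max\{d_X(x,x'),d_X(y,y')\}$. Let $C_*$ be the space of continuous functions $X\times X\to\mathbb{R}$ (with the topology of uniform convergence on compact sets) modulo additive constants, and embed $X\times X$ in $C_*$ by $\iota(x,y)=[d_{\max}((x,y),\cdot)]$. Then $\overline{X\times X}^{\max}$ is the closure of $\iota(X\times X)$ in $C_*$ and $\partial_\infty^{\max}(X\times X)=\overline{X\times X}^{\max}\setminus\iota(X\times X)$. The singular part $\partial_\infty^{\max}(X\times X)_{\mathrm{sing}}$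 (with the subspace topology) is the set of boundary points having a representative of the form $(z,z')\mapsto\beta^{o}_{\xi}(z)$ or $(z,z')\mapsto\beta^{o}_{\xi'}(z')$ with $\xi,\xi'\in\partial_\infty X$. *)

theory Defs
  imports "HOL-Analysis.Analysis"
begin

definition proper_space :: "'a::metric_space itself \<Rightarrow> bool" where
  "proper_space _ \<longleftrightarrow> (\<forall>(x::'a) r. compact (cball x r))"

definition geodesic_segment :: "'a::metric_space \<Rightarrow> 'a \<Rightarrow> (real \<Rightarrow> 'a) \<Rightarrow> bool" where
  "geodesic_segment x y c \<longleftrightarrow>
     c 0 = x \<and> c (dist x y) = y \<and>
     (\<forall>s\<in>{0..dist x y}. \<forall>t\<in>{0..dist x y}. dist (c s) (c t) = \<bar>s - t\<bar>)"

text \<open>The model plane of curvature -1 is the upper sheet of the hyperboloid, with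
  \<open>cosh d(u,v) = u\<^sub>0 v\<^sub>0 - u\<^sub>1 v\<^sub>1 - u\<^sub>2 v\<^sub>2\<close>.\<close>

definition lorentz_form :: "real \<times> real \<times> real \<Rightarrow> real \<times> real \<times> real \<Rightarrow> real" where
  "lorentz_form = (\<lambda>(u0, u1, u2) (v0, v1, v2). u0 * v0 - u1 * v1 - u2 * v2)"

definition hyp_plane :: "(real \<times> real \<times> real) set" where
  "hyp_plane = {u. lorentz_form u u = 1 \<and> fst u > 0}"

definition hyp_dist :: "real \<times> real \<times> real \<Rightarrow> real \<times> real \<times> real \<Rightarrow> real" where
  "hyp_dist u v = arcosh (lorentz_form u v)"

definition comparison_triangle ::
  "'a::metric_space \<Rightarrow> 'a \<Rightarrow> 'a \<Rightarrow>
   real \<times> real \<times> real \<Rightarrow> real \<times> real \<times> real \<Rightarrow> real \<times> real \<times> real \<Rightarrow> bool" where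
  "comparison_triangle x y z x' y' z' \<longleftrightarrow>
     x' \<in> hyp_plane \<and> y' \<in> hyp_plane \<and> z' \<in> hyp_plane \<and>
     hyp_dist x' y' = dist x y \<and> hyp_dist y' z' = dist y z \<and> hyp_dist z' x' = dist z x"

text \<open>For a geodesic segment from \<open>x\<close> to \<open>y\<close> and a segment \<open>[x', y']\<close> of the same length in the
  model plane, the comparison point of the point at distance \<open>s\<close> from \<open>x\<close> is the point of
  \<open>[x', y']\<close> at distance \<open>s\<close> from \<open>x'\<close>.\<close>

definition comparison_point ::
  "real \<times> real \<times> real \<Rightarrow> real \<times> real \<times> real \<Rightarrow> real \<Rightarrow> real \<times> real \<times> real \<Rightarrow> bool" where
  "comparison_point x' y' s p' \<longleftrightarrow>
     p' \<in> hyp_plane \<and> hyp_dist x' p' = s \<and> hyp_dist p' y' = hyp_dist x' y' - s"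

text \<open>The comparison triangle is unique up to isometries of the model plane, so it does not
  matter which one is used.\<close>

definition CAT_neg1_triangle ::
  "'a::metric_space \<Rightarrow> 'a \<Rightarrow> 'a \<Rightarrow> (real \<Rightarrow> 'a) \<Rightarrow> (real \<Rightarrow> 'a) \<Rightarrow> (real \<Rightarrow> 'a) \<Rightarrow> bool" where
  "CAT_neg1_triangle x y z cxy cyz czx \<longleftrightarrow>
     (\<exists>x' y' z'. comparison_triangle x y z x' y' z' \<and>
       (let sides = {(x, y, cxy, x', y'), (y, z, cyz, y', z'), (z, x, czx, z', x')} in
        \<forall>(a, b, c, a', b') \<in> sides. \<forall>(e, f, d, e', f') \<in> sides.
        \<forall>s\<in>{0..dist a b}. \<forall>t\<in>{0..dist e f}.
        \<forall>p' q'. comparison_point a' b' s p' \<and> comparison_point e' f' t q' \<longrightarrow>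
          dist (c s) (d t) \<le> hyp_dist p' q'))"

definition CAT_neg1_space :: "'a::metric_space itself \<Rightarrow> bool" where
  "CAT_neg1_space _ \<longleftrightarrow>
     (\<forall>x y :: 'a. \<exists>c. geodesic_segment x y c) \<and>
     (\<forall>(x::'a) y z cxy cyz czx.
        geodesic_segment x y cxy \<and> geodesic_segment y z cyz \<and> geodesic_segment z x czx \<longrightarrow>
        CAT_neg1_triangle x y z cxy cyz czx)"

text \<open>The topology of uniform convergence on compact subsets of \<open>D\<close>, on a set \<open>F\<close> of functions.\<close>

definition ucc_topology ::
  "'a::topological_space set \<Rightarrow> ('a \<Rightarrow> 'b::metric_space) set \<Rightarrow> ('a \<Rightarrow> 'b) topology" where
  "ucc_topology D F = topology (\<lambda>U. U \<subseteq> F \<and>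
     (\<forall>f\<in>U. \<exists>K e. compact K \<and> K \<subseteq> D \<and> e > 0 \<and>
        (\<forall>g\<in>F. (\<forall>x\<in>K. dist (f x) (g x) < e) \<longrightarrow> g \<in> U)))"

lemma openin_ucc_topology:
  "openin (ucc_topology D F) U \<longleftrightarrow> U \<subseteq> F \<and>
     (\<forall>f\<in>U. \<exists>K e. compact K \<and> K \<subseteq> D \<and> e > 0 \<and>
        (\<forall>g\<in>F. (\<forall>x\<in>K. dist (f x) (g x) < e) \<longrightarrow> g \<in> U))"
proof -
  define Q where "Q U f \<longleftrightarrow> (\<exists>K e. compact K \<and> K \<subseteq> D \<and> e > (0::real) \<and>
        (\<forall>g\<in>F. (\<forall>x\<in>K. dist (f x) (g x) < e) \<longrightarrow> g \<in> U))" for U f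
  have Q_Int: "Q (S \<inter> T) f" if S: "Q S f" and T: "Q T f" for S T f
  proof -
    from S obtain K1 e1 where 1: "compact K1" "K1 \<subseteq> D" "e1 > 0"
      "\<forall>g\<in>F. (\<forall>x\<in>K1. dist (f x) (g x) < e1) \<longrightarrow> g \<in> S" unfolding Q_def by blast
    from T obtain K2 e2 where 2: "compact K2" "K2 \<subseteq> D" "e2 > 0"
      "\<forall>g\<in>F. (\<forall>x\<in>K2. dist (f x) (g x) < e2) \<longrightarrow> g \<in> T" unfolding Q_def by blast
    show ?thesis
      unfolding Q_def
    proof (intro exI conjI ballI impI)
      show "compact (K1 \<union> K2)" "K1 \<union> K2 \<subseteq> D" "min e1 e2 > 0"
        using 1(1-3) 2(1-3) by auto
      fix g assume g: "g \<in> F" and d: "\<forall>x\<in>K1 \<union> K2. dist (f x) (g x) < min e1 e2"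
      have "\<forall>x\<in>K1. dist (f x) (g x) < e1" "\<forall>x\<in>K2. dist (f x) (g x) < e2"
        using d by simp_all
      then show "g \<in> S \<inter> T" using 1(4) 2(4) g by simp
    qed
  qed
  have Q_mono: "Q T f" if "Q S f" "S \<subseteq> T" for S T f
    using that(1) subsetD[OF that(2)] unfolding Q_def by fast
  have "istopology (\<lambda>U. U \<subseteq> F \<and> (\<forall>f\<in>U. Q U f))"
    unfolding istopology_def
  proof (intro conjI allI impI)
    fix S T assume ST: "S \<subseteq> F \<and> (\<forall>f\<in>S. Q S f)" "T \<subseteq> F \<and> (\<forall>f\<in>T. Q T f)"
    then show "S \<inter> T \<subseteq> F" by blast
    show "\<forall>f\<in>S \<inter> T. Q (S \<inter> T) f" using ST by (simp add: Q_Int)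
  next
    fix \<K> assume \<K>: "\<forall>U\<in>\<K>. U \<subseteq> F \<and> (\<forall>f\<in>U. Q U f)"
    then show "\<Union>\<K> \<subseteq> F" by blast
    show "\<forall>f\<in>\<Union>\<K>. Q (\<Union>\<K>) f"
    proof
      fix f assume "f \<in> \<Union>\<K>"
      then obtain S where S: "S \<in> \<K>" "f \<in> S" by (rule UnionE)
      then have "Q S f" using \<K> by blast
      then show "Q (\<Union>\<K>) f" using S(1) by (rule Q_mono[OF _ Union_upper])
    qed
  qed
  then show ?thesis by (simp add: ucc_topology_def topology_inverse' Q_def)
qed

lemma topspace_ucc_topology [simp]: "topspace (ucc_topology D F) = F"
proof
  show "topspace (ucc_topology D F) \<subseteq> F"
    using openin_topspace[of "ucc_topology D F"] unfolding openin_ucc_topology by blast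
  have "openin (ucc_topology D F) F"
    unfolding openin_ucc_topology
  proof (intro conjI ballI exI impI)
    show "compact {}" "{} \<subseteq> D" "(0::real) < 1" by simp_all
  qed simp_all
  then show "F \<subseteq> topspace (ucc_topology D F)" by (rule openin_subset)
qed

text \<open>The finest topology on \<open>Y\<close> making the map \<open>q\<close> continuous; it is the quotient topology
  when \<open>q\<close> maps onto \<open>Y\<close>.\<close>

definition final_topology :: "'a topology \<Rightarrow> 'b set \<Rightarrow> ('a \<Rightarrow> 'b) \<Rightarrow> 'b topology" where
  "final_topology T Y q = topology (\<lambda>U. U \<subseteq> Y \<and> openin T {x \<in> topspace T. q x \<in> U})"

lemma openin_final_topology:
  "openin (final_topology T Y q) U \<longleftrightarrow> U \<subseteq> Y \<and> openin T {x \<in> topspace T. q x \<in> U}"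
proof -
  have 1: "{x \<in> topspace T. q x \<in> A \<inter> B} = {x \<in> topspace T. q x \<in> A} \<inter> {x \<in> topspace T. q x \<in> B}"
    for A B by auto
  have 2: "{x \<in> topspace T. q x \<in> \<Union>\<K>} = (\<Union>K\<in>\<K>. {x \<in> topspace T. q x \<in> K})" for \<K>
    by auto
  have "istopology (\<lambda>U. U \<subseteq> Y \<and> openin T {x \<in> topspace T. q x \<in> U})"
    unfolding istopology_def 1 2 by blast
  then show ?thesis by (simp add: final_topology_def topology_inverse')
qed

lemma topspace_final_topology:
  assumes "q ` topspace T \<subseteq> Y"
  shows "topspace (final_topology T Y q) = Y"
proof
  show "topspace (final_topology T Y q) \<subseteq> Y"
    using openin_topspace[of "final_topology T Y q"] unfolding openin_final_topology by blast
  have "{x \<in> topspace T. q x \<in> Y} = topspace T" using assms by auto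
  then have "openin (final_topology T Y q) Y"
    unfolding openin_final_topology by simp
  then show "Y \<subseteq> topspace (final_topology T Y q)" by (rule openin_subset)
qed

text \<open>A ray is a function on \<open>[0,\<infinity>)\<close>; extensionality makes it unique as a function on the reals.\<close>

definition geodesic_rays :: "(real \<Rightarrow> 'a::metric_space) set" where
  "geodesic_rays =
     {c \<in> extensional {0..}. \<forall>s\<ge>0. \<forall>t\<ge>0. dist (c s) (c t) = \<bar>s - t\<bar>}"

definition asymptotic_rel :: "((real \<Rightarrow> 'a::metric_space) \<times> (real \<Rightarrow> 'a)) set" where
  "asymptotic_rel = {(c, c'). c \<in> geodesic_rays \<and> c' \<in> geodesic_rays \<and>
     (\<exists>K. \<forall>t\<ge>0. dist (c t) (c' t) \<le> K)}"

definition ideal_boundary :: "(real \<Rightarrow> 'a::metric_space) set set" where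
  "ideal_boundary = geodesic_rays // asymptotic_rel"

text \<open>The cone topology: boundary points are identified with the rays issuing from the base
  point, with uniform convergence on compact sets.\<close>

definition ideal_boundary_topology ::
  "'a::metric_space \<Rightarrow> (real \<Rightarrow> 'a) set topology" where
  "ideal_boundary_topology x\<^sub>0 =
     final_topology (ucc_topology {0..} {c \<in> geodesic_rays. c 0 = x\<^sub>0})
       ideal_boundary (\<lambda>c. asymptotic_rel `` {c})"

definition busemann :: "'a::metric_space \<Rightarrow> (real \<Rightarrow> 'a) set \<Rightarrow> 'a \<Rightarrow> real" where
  "busemann p \<xi> x =
     (let c = (THE c. c \<in> \<xi> \<and> c 0 = p) in Lim at_top (\<lambda>t. dist x (c t) - t))"

definition dmax :: "'a::metric_space \<times> 'a \<Rightarrow> 'a \<times> 'a \<Rightarrow> real" where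
  "dmax = (\<lambda>(x, y) (x', y'). max (dist x x') (dist y y'))"

text \<open>Continuity and compactness in \<open>X \<times> X\<close> refer to the product topology, which is the one
  induced by \<^const>\<open>dmax\<close>.\<close>

definition mod_const_rel ::
  "((('a::metric_space \<times> 'a) \<Rightarrow> real) \<times> (('a \<times> 'a) \<Rightarrow> real)) set" where
  "mod_const_rel = {(f, g). continuous_on UNIV f \<and> continuous_on UNIV g \<and>
     (\<exists>k. \<forall>w. g w = f w + k)}"

definition mod_const_class ::
  "(('a::metric_space \<times> 'a) \<Rightarrow> real) \<Rightarrow> (('a \<times> 'a) \<Rightarrow> real) set" where
  "mod_const_class f = mod_const_rel `` {f}"

definition Cstar :: "(('a::metric_space \<times> 'a) \<Rightarrow> real) set topology" where
  "Cstar = final_topology (ucc_topology UNIV {f. continuous_on UNIV f})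
     ({f. continuous_on UNIV f} // mod_const_rel) mod_const_class"

definition iota_max :: "'a::metric_space \<times> 'a \<Rightarrow> (('a \<times> 'a) \<Rightarrow> real) set" where
  "iota_max w = mod_const_class (dmax w)"

definition max_compactification :: "(('a::metric_space \<times> 'a) \<Rightarrow> real) set set" where
  "max_compactification = Cstar closure_of range iota_max"

definition max_boundary :: "(('a::metric_space \<times> 'a) \<Rightarrow> real) set set" where
  "max_boundary = max_compactification - range iota_max"

definition max_boundary_sing ::
  "'a::metric_space \<Rightarrow> (('a \<times> 'a) \<Rightarrow> real) set set" where
  "max_boundary_sing x\<^sub>0 = {P \<in> max_boundary.
     (\<exists>\<xi>\<in>ideal_boundary. (\<lambda>(z, z'). busemann x\<^sub>0 \<xi> z) \<in> P) \<or>
     (\<exists>\<xi>'\<in>ideal_boundary. (\<lambda>(z, z'). busemann x\<^sub>0 \<xi>' z') \<in> P)}"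

definition phi_sing ::
  "'a::metric_space \<Rightarrow> (('a \<times> 'a) \<Rightarrow> real) set \<Rightarrow> nat \<times> (real \<Rightarrow> 'a) set" where
  "phi_sing x\<^sub>0 P = (THE q.
     (\<exists>\<xi>\<in>ideal_boundary. (\<lambda>(z, z'). busemann x\<^sub>0 \<xi> z) \<in> P \<and> q = (1, \<xi>)) \<or>
     (\<exists>\<xi>'\<in>ideal_boundary. (\<lambda>(z, z'). busemann x\<^sub>0 \<xi>' z') \<in> P \<and> q = (2, \<xi>')))"

end

theory Submission
  imports Defs "HOL-Real_Asymp.Real_Asymp"
begin

text \<open>A class in the singular boundary is given by a factor and a ray \<open>c\<close> from \<open>x\<^sub>0\<close>, whose
  Busemann function \<open>b\<close> is evaluated in that factor. The claim is that the factor and the ray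
  can be recovered from the class, continuously in both directions.

  All the geometry is contained in one inequality. In the hyperbolic plane, Stewart's theorem
  expresses the hyperbolic cosine of the distance from a point to a point of a segment linearly
  in those of the distances to the endpoints. In a \<open>CAT(-1)\<close> space this becomes an upper bound
  (\<open>stewart\<close>). If one endpoint runs to infinity along a ray \<open>c\<close>, the bound becomes
  \<open>cosh (dist x (c t)) \<le> exp (- t) * cosh (dist x (c 0)) + sinh t * exp (b x)\<close>
  (\<open>cosh_dist_ray_le\<close>), which has two consequences.

  First, \<open>dist x (c t) - t\<close> converges to the Busemann function exponentially fast, at a rate
  that depends only on the distance of \<open>x\<close> from \<open>x\<^sub>0\<close>. Therefore rays that are close at one late
  time have Busemann functions that are close on a given compact set, and the map from rays to
  classes is continuous (\<open>open_endpoints_factor_class\<close>).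

  Second, if the Busemann function of a ray \<open>c'\<close> from \<open>x\<^sub>0\<close> is at most \<open>- t + \<epsilon>\<close> at \<open>c t\<close>, where
  \<open>- t\<close> is its least possible value, then the hyperbolic cosine of the distance between \<open>c t\<close> and
  \<open>c' t\<close> is at most \<open>exp \<epsilon>\<close> (\<open>cosh_dist_rays_le\<close>). Thus a Busemann function determines its
  ray, and two values of the function, at \<open>x\<^sub>0\<close> and at a point \<open>c T\<close>, determine the ray up to a
  small error on the whole interval from \<open>0\<close> to \<open>T\<close>. The condition on these two values is open
  modulo constants, and it fails for functions of the other factor, so the inverse map is
  continuous as well (\<open>factor_class_nhd\<close>).

  It remains to see that every boundary point is represented by exactly one ray from \<open>x\<^sub>0\<close>
  (\<open>asymptotic_ray_exists\<close>, \<open>asymptotic_rays_eq\<close>) and that every function in question is a limit of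
  distance functions (\<open>factor_class_in_max_boundary\<close>).\<close>

section \<open>The hyperbolic plane\<close>

lemma lorentz_form_ge_1:
  assumes "u \<in> hyp_plane" "v \<in> hyp_plane"
  shows "lorentz_form u v \<ge> 1"
proof -
  obtain u0 u1 u2 v0 v1 v2 where uv: "u = (u0, u1, u2)" "v = (v0, v1, v2)"
    by (metis prod_cases3)
  have u: "u0\<^sup>2 = 1 + u1\<^sup>2 + u2\<^sup>2" "u0 > 0" and v: "v0\<^sup>2 = 1 + v1\<^sup>2 + v2\<^sup>2" "v0 > 0"
    using assms by (auto simp: uv hyp_plane_def lorentz_form_def power2_eq_square)
  have "(u0 * v0)\<^sup>2 - (1 + u1 * v1 + u2 * v2)\<^sup>2
      = (u1 - v1)\<^sup>2 + (u2 - v2)\<^sup>2 + (u1 * v2 - u2 * v1)\<^sup>2"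
    unfolding power_mult_distrib u(1) v(1) by (simp add: power2_eq_square algebra_simps)
  then have "(1 + u1 * v1 + u2 * v2)\<^sup>2 \<le> (u0 * v0)\<^sup>2"
    by (smt (verit) zero_le_power2)
  then have "1 + u1 * v1 + u2 * v2 \<le> u0 * v0"
    using u(2) v(2) by (auto intro: power2_le_imp_le[of "1 + u1 * v1 + u2 * v2"])
  then show ?thesis by (simp add: uv lorentz_form_def)
qed

lemma cosh_hyp_dist:
  "u \<in> hyp_plane \<Longrightarrow> v \<in> hyp_plane \<Longrightarrow> cosh (hyp_dist u v) = lorentz_form u v"
  by (simp add: hyp_dist_def lorentz_form_ge_1)

lemma hyp_dist_eqI: "lorentz_form u v = cosh a \<Longrightarrow> a \<ge> 0 \<Longrightarrow> hyp_dist u v = a"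
  by (simp add: hyp_dist_def arcosh_cosh_real)

lemma lorentz_form_commute: "lorentz_form u v = lorentz_form v u"
  by (cases u; cases v) (simp add: lorentz_form_def mult.commute)

lemma lorentz_form_combine:
  "lorentz_form w (a *\<^sub>R u + b *\<^sub>R v) = a * lorentz_form w u + b * lorentz_form w v"
  by (cases u; cases v; cases w) (simp add: lorentz_form_def algebra_simps)

text \<open>The point at distance \<open>s\<close> on a segment of length \<open>d\<close> lies in the plane spanned by the
  endpoints, so its distances to all other points are governed by a linear relation between
  hyperbolic cosines. This is the hyperbolic form of Stewart's theorem.\<close>

lemma hyp_plane_stewart:
  assumes u: "u \<in> hyp_plane" and v: "v \<in> hyp_plane" and d: "hyp_dist u v = d" "d > 0"
    and s: "0 \<le> s" "s \<le> d"
  obtains p where "comparison_point u v s p"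
    "\<And>w. w \<in> hyp_plane \<Longrightarrow> cosh (hyp_dist p w) * sinh d =
       sinh (d - s) * cosh (hyp_dist w u) + sinh s * cosh (hyp_dist w v)"
proof -
  define a b where "a = sinh (d - s) / sinh d" and "b = sinh s / sinh d"
  define p where "p = a *\<^sub>R u + b *\<^sub>R v"
  have sd: "sinh d > 0" using d by simp
  have uu: "lorentz_form u u = 1" and vv: "lorentz_form v v = 1"
    using u v by (auto simp: hyp_plane_def)
  have uv: "lorentz_form u v = cosh d" using cosh_hyp_dist[OF u v] d by simp
  have ab: "a \<ge> 0" "b \<ge> 0" using s sd by (auto simp: a_def b_def)
  have up: "lorentz_form u p = cosh s"
  proof -
    have "sinh (d - s) + sinh s * cosh d = cosh s * sinh d"
      by (simp add: sinh_diff)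
    then show ?thesis using sd by (simp add: p_def lorentz_form_combine uu uv a_def b_def field_simps)
  qed
  have vp: "lorentz_form v p = cosh (d - s)"
  proof -
    have "sinh (d - s) * cosh d + sinh s = cosh (d - s) * sinh d"
      using sinh_diff[of d "d - s"] by simp
    then show ?thesis using sd
      by (simp add: p_def lorentz_form_combine vv lorentz_form_commute[of v u] uv a_def b_def field_simps)
  qed
  have pp: "lorentz_form p p = 1"
  proof -
    have "lorentz_form p p = a * lorentz_form u p + b * lorentz_form v p"
      by (metis lorentz_form_combine lorentz_form_commute p_def)
    also have "\<dots> = (sinh (d - s) * cosh s + cosh (d - s) * sinh s) / sinh d"
      by (simp add: up vp a_def b_def add_divide_distrib mult.commute)
    also have "sinh (d - s) * cosh s + cosh (d - s) * sinh s = sinh d"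
      using sinh_add[of "d - s" s] by simp
    finally show ?thesis using sd by simp
  qed
  have p0: "fst p > 0"
  proof -
    have "a > 0 \<or> b > 0" using s d(2) sd by (cases "s = 0") (auto simp: a_def b_def)
    moreover have "fst u > 0" "fst v > 0" using u v by (auto simp: hyp_plane_def)
    ultimately show ?thesis using ab
      by (auto simp: p_def intro: add_pos_nonneg add_nonneg_pos)
  qed
  have p: "p \<in> hyp_plane" using pp p0 by (simp add: hyp_plane_def)
  show ?thesis
  proof
    show "comparison_point u v s p"
      unfolding comparison_point_def using p s
      by (auto simp: d lorentz_form_commute[of p v] intro!: hyp_dist_eqI up vp)
    fix w assume w: "w \<in> hyp_plane"
    have "lorentz_form p w = a * lorentz_form w u + b * lorentz_form w v"
      by (metis lorentz_form_combine lorentz_form_commute p_def)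
    then show "cosh (hyp_dist p w) * sinh d =
       sinh (d - s) * cosh (hyp_dist w u) + sinh s * cosh (hyp_dist w v)"
      using sd by (simp add: cosh_hyp_dist p w u v a_def b_def field_simps)
  qed
qed

section \<open>Estimates for hyperbolic functions\<close>

lemma sinh_diff_le: "0 \<le> t \<Longrightarrow> sinh (a - t) \<le> exp (- t) * sinh (a::real)"
proof -
  assume "0 \<le> t"
  then have "exp (- a - t) \<le> exp (t - a)" by simp
  moreover have "2 * sinh (a - t) = exp (a - t) - exp (t - a)"
    by (simp add: sinh_field_def)
  moreover have "2 * (exp (- t) * sinh a) = exp (a - t) - exp (- a - t)"
    by (simp add: sinh_field_def right_diff_distrib flip: exp_add)
  ultimately show ?thesis by linarith
qed

lemma sinh_ge_exp: "(a::real) \<ge> 1 \<Longrightarrow> exp a \<le> 4 * sinh a"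
proof -
  assume a: "a \<ge> 1"
  have "2 * exp (- a) \<le> exp 1 * exp (- a)" using exp_ge_add_one_self[of 1] by simp
  also have "\<dots> \<le> exp a" using a by (simp flip: exp_add)
  finally show ?thesis by (simp add: sinh_field_def)
qed

lemma cosh_le_exp: "(a::real) \<ge> 0 \<Longrightarrow> cosh a \<le> exp a"
  by (simp add: cosh_field_def)

lemma cosh_le_imp_le: "cosh (a::real) \<le> cosh b \<Longrightarrow> b \<ge> 0 \<Longrightarrow> a \<le> b"
  using cosh_real_nonneg_less_iff[of b a] by linarith

text \<open>Busemann functions enter the estimates below through this limit, with \<open>D T\<close> the distance
  from a fixed point to the point of a ray at time \<open>T\<close>.\<close>

lemma tendsto_cosh_div_sinh:
  fixes D :: "real \<Rightarrow> real"
  assumes "((\<lambda>T. D T - T) \<longlongrightarrow> b) at_top"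
  shows "((\<lambda>T. cosh (D T) / sinh T) \<longlongrightarrow> exp b) at_top"
proof -
  have e: "((\<lambda>T::real. exp (- 2 * T)) \<longlongrightarrow> 0) at_top" by real_asymp
  have "((\<lambda>T. (exp (D T - T) + exp (- (D T - T)) * exp (- 2 * T)) / (1 - exp (- 2 * T)))
      \<longlongrightarrow> (exp b + exp (- b) * 0) / (1 - 0)) at_top"
    by (intro tendsto_intros assms e) simp
  moreover have "cosh (D T) / sinh T =
     (exp (D T - T) + exp (- (D T - T)) * exp (- 2 * T)) / (1 - exp (- 2 * T))" for T
  proof -
    have 1: "exp (D T - T) + exp (- (D T - T)) * exp (- 2 * T) = 2 * exp (- T) * cosh (D T)"
      by (simp add: cosh_field_def algebra_simps flip: exp_add)
    have 2: "1 - exp (- 2 * T) = 2 * exp (- T) * sinh T"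
      by (simp add: sinh_field_def algebra_simps flip: exp_add)
    show ?thesis unfolding 1 2 by simp
  qed
  ultimately show ?thesis by simp
qed

section \<open>Busemann functions of geodesic rays\<close>

lemma geodesic_raysD:
  "c \<in> geodesic_rays \<Longrightarrow> 0 \<le> s \<Longrightarrow> 0 \<le> t \<Longrightarrow> dist (c s) (c t) = \<bar>s - t\<bar>"
  by (simp add: geodesic_rays_def)

lemma geodesic_ray_segment:
  "c \<in> geodesic_rays \<Longrightarrow> 0 \<le> T \<Longrightarrow> geodesic_segment (c 0) (c T) c"
  by (simp add: geodesic_segment_def geodesic_raysD)

definition ray_busemann :: "(real \<Rightarrow> 'a::metric_space) \<Rightarrow> 'a \<Rightarrow> real" where
  "ray_busemann c x = Lim at_top (\<lambda>t. dist x (c t) - t)"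

lemma ray_busemann_tendsto:
  assumes c: "c \<in> geodesic_rays"
  shows "((\<lambda>t. dist x (c t) - t) \<longlongrightarrow> ray_busemann c x) at_top"
proof -
  define l where "l = (INF t\<in>{0..}. dist x (c t) - t)"
  have lower: "- dist x (c 0) \<le> dist x (c t) - t" if "t \<ge> 0" for t
    using geodesic_raysD[OF c that order.refl] dist_triangle3[of "c t" "c 0" x] that by simp
  have bdd: "bdd_below ((\<lambda>t. dist x (c t) - t) ` {0..})"
    using lower by (intro bdd_belowI2[of _ "- dist x (c 0)"]) simp
  have "((\<lambda>t. dist x (c t) - t) \<longlongrightarrow> l) at_top"
  proof (rule decreasing_tendsto)
    show "\<forall>\<^sub>F t in at_top. l \<le> dist x (c t) - t"
      using eventually_ge_at_top[of "0::real"] by eventually_elim (auto simp: l_def intro: cINF_lower[OF bdd])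
    fix y assume "l < y"
    then obtain s where s: "s \<ge> 0" "dist x (c s) - s < y"
      unfolding l_def by (subst (asm) cINF_less_iff[OF _ bdd]) auto
    show "\<forall>\<^sub>F t in at_top. dist x (c t) - t < y"
      using eventually_ge_at_top[of s]
    proof eventually_elim
      case (elim t)
      have "dist (c s) (c t) = t - s" using geodesic_raysD[OF c s(1), of t] s(1) elim by simp
      then show ?case using dist_triangle[of x "c t" "c s"] s(2) by linarith
    qed
  qed
  then show ?thesis by (simp add: ray_busemann_def tendsto_Lim)
qed

text \<open>The expression \<open>dist x (c t) - t\<close> decreases in \<open>t\<close> by the triangle inequality, so it
  approximates the Busemann function from above.\<close>

lemma ray_busemann_le:
  assumes c: "c \<in> geodesic_rays" and t: "t \<ge> 0"
  shows "ray_busemann c x \<le> dist x (c t) - t"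
proof (rule tendsto_upperbound[OF ray_busemann_tendsto[OF c]])
  show "\<forall>\<^sub>F s in at_top. dist x (c s) - s \<le> dist x (c t) - t"
    using eventually_ge_at_top[of t]
  proof eventually_elim
    case (elim s)
    have "dist (c t) (c s) = s - t" using geodesic_raysD[OF c t, of s] t elim by simp
    then show ?case using dist_triangle[of x "c s" "c t"] by linarith
  qed
qed simp

lemma ray_busemann_lipschitz:
  assumes c: "c \<in> geodesic_rays"
  shows "ray_busemann c x \<le> ray_busemann c y + dist x y"
proof (rule tendsto_le[OF _ _ ray_busemann_tendsto[OF c]])
  show "((\<lambda>t. dist y (c t) - t + dist x y) \<longlongrightarrow> ray_busemann c y + dist x y) at_top"
    by (intro tendsto_add ray_busemann_tendsto c tendsto_const)
  show "\<forall>\<^sub>F t in at_top. dist x (c t) - t \<le> dist y (c t) - t + dist x y"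
    by (intro always_eventually allI) (simp add: dist_triangle add.commute)
qed simp

lemma ray_busemann_along:
  assumes c: "c \<in> geodesic_rays" and t: "t \<ge> 0"
  shows "ray_busemann c (c t) = - t"
proof (rule tendsto_unique[OF _ ray_busemann_tendsto[OF c]])
  show "((\<lambda>s. dist (c t) (c s) - s) \<longlongrightarrow> - t) at_top"
  proof (rule tendsto_eventually)
    show "\<forall>\<^sub>F s in at_top. dist (c t) (c s) - s = - t"
      using eventually_ge_at_top[of t] by eventually_elim (use c t in \<open>simp add: geodesic_raysD\<close>)
  qed
qed simp

lemma continuous_ray_busemann:
  assumes c: "c \<in> geodesic_rays"
  shows "continuous_on UNIV (ray_busemann c)"
proof -
  have "\<bar>ray_busemann c x - ray_busemann c y\<bar> \<le> dist x y" for x y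
    using ray_busemann_lipschitz[OF c, of x y] ray_busemann_lipschitz[OF c, of y x]
    by (simp add: dist_commute)
  then have "1-lipschitz_on UNIV (ray_busemann c)"
    by (intro lipschitz_onI) (auto simp: dist_real_def)
  then show ?thesis by (rule lipschitz_on_continuous_on)
qed

section \<open>The curvature bound along rays\<close>

locale CAT_neg1 =
  fixes x\<^sub>0 :: "'a::metric_space"
  assumes CAT: "CAT_neg1_space TYPE('a)"
begin

text \<open>Comparing the triangle spanned by \<open>x\<close>, \<open>y\<close> and \<open>z\<close> with one in the hyperbolic plane
  turns the equation of Stewart's theorem into an inequality. Every use of the curvature bound
  below goes through this inequality.\<close>

lemma stewart:
  assumes g: "geodesic_segment x y \<sigma>" and s: "0 \<le> s" "s \<le> dist x y"
  shows "cosh (dist z (\<sigma> s)) * sinh (dist x y)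
     \<le> sinh (dist x y - s) * cosh (dist z x) + sinh s * cosh (dist z (y::'a))"
proof (cases "x = y")
  case True
  then show ?thesis using s by simp
next
  case False
  obtain cyz czx where yz: "geodesic_segment y z cyz" and zx: "geodesic_segment z x czx"
    using CAT unfolding CAT_neg1_space_def by metis
  have "CAT_neg1_triangle x y z \<sigma> cyz czx"
    using CAT g yz zx unfolding CAT_neg1_space_def by blast
  then obtain x' y' z' where tri: "comparison_triangle x y z x' y' z'"
    and cmp: "\<And>p' q'. comparison_point x' y' s p' \<Longrightarrow> comparison_point z' x' 0 q' \<Longrightarrow>
          dist (\<sigma> s) (czx 0) \<le> hyp_dist p' q'"
    unfolding CAT_neg1_triangle_def Let_def using s by fastforce
  from tri have H: "x' \<in> hyp_plane" "y' \<in> hyp_plane" "z' \<in> hyp_plane"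
    and d: "hyp_dist x' y' = dist x y" "hyp_dist y' z' = dist y z" "hyp_dist z' x' = dist z x"
    unfolding comparison_triangle_def by auto
  obtain p where p: "comparison_point x' y' s p" and
    eq: "\<And>w. w \<in> hyp_plane \<Longrightarrow> cosh (hyp_dist p w) * sinh (dist x y) =
       sinh (dist x y - s) * cosh (hyp_dist w x') + sinh s * cosh (hyp_dist w y')"
    by (rule hyp_plane_stewart[OF H(1,2) d(1) _ s]) (use False in auto)
  \<comment> \<open>The vertex \<open>z\<close> corresponds to the vertex \<open>z'\<close>, at distance 0 from the start of the side \<open>czx\<close>.\<close>
  have "comparison_point z' x' 0 z'"
    using H unfolding comparison_point_def by (auto intro!: hyp_dist_eqI simp: hyp_plane_def)
  then have le: "dist (\<sigma> s) z \<le> hyp_dist p z'"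
    using cmp[OF p] zx by (simp add: geodesic_segment_def)
  have "cosh (dist z (\<sigma> s)) \<le> cosh (hyp_dist p z')"
    using le by (subst cosh_real_nonneg_le_iff) (auto simp: dist_commute intro: order_trans[OF zero_le_dist])
  then have "cosh (dist z (\<sigma> s)) * sinh (dist x y) \<le> cosh (hyp_dist p z') * sinh (dist x y)"
    by (intro mult_right_mono) auto
  also have "\<dots> = sinh (dist x y - s) * cosh (dist z x) + sinh s * cosh (dist z y)"
    using eq[OF H(3)] d(2,3) lorentz_form_commute[of z' y'] dist_commute[of y z]
    by (simp only: hyp_dist_def)
  finally show ?thesis .
qed

text \<open>Letting the far endpoint of the segment run to infinity turns Stewart's inequality into a
  bound for the distance to a ray in terms of the Busemann function.\<close>

lemma cosh_dist_ray_le: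
  fixes c :: "real \<Rightarrow> 'a"
  assumes c: "c \<in> geodesic_rays" and t: "t \<ge> 0"
  shows "cosh (dist x (c t)) \<le> exp (- t) * cosh (dist x (c 0)) + sinh t * exp (ray_busemann c x)"
proof (rule tendsto_lowerbound)
  show "((\<lambda>T. exp (- t) * cosh (dist x (c 0)) + sinh t * (cosh (dist x (c T)) / sinh T)) \<longlongrightarrow>
     exp (- t) * cosh (dist x (c 0)) + sinh t * exp (ray_busemann c x)) at_top"
    by (intro tendsto_intros tendsto_cosh_div_sinh ray_busemann_tendsto c)
  show "\<forall>\<^sub>F T in at_top. cosh (dist x (c t))
     \<le> exp (- t) * cosh (dist x (c 0)) + sinh t * (cosh (dist x (c T)) / sinh T)"
    using eventually_gt_at_top[of t]
  proof eventually_elim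
    case (elim T)
    have T: "sinh T > 0" "dist (c 0) (c T) = T" using elim t geodesic_raysD[OF c order.refl, of T] by auto
    have "cosh (dist x (c t)) * sinh T
       \<le> sinh (T - t) * cosh (dist x (c 0)) + sinh t * cosh (dist x (c T))"
      using stewart[OF geodesic_ray_segment[OF c], of T t x] T(2) t elim by simp
    also have "\<dots> \<le> exp (- t) * sinh T * cosh (dist x (c 0)) + sinh t * cosh (dist x (c T))"
      using sinh_diff_le[OF t, of T] by (intro add_right_mono mult_right_mono) auto
    finally show ?case using T(1) by (simp add: field_simps)
  qed
qed simp

text \<open>The speed at which the Busemann function is approximated depends on the distance of \<open>x\<close>
  from the origin of the ray, but not on the direction of the ray. This uniformity makes the
  Busemann function depend continuously on the ray.\<close>

lemma ray_busemann_approx: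
  fixes c :: "real \<Rightarrow> 'a"
  assumes c: "c \<in> geodesic_rays" and t: "t \<ge> 0"
  shows "dist x (c t) - t - ray_busemann c x
     \<le> 2 * exp (dist x (c 0) - 2 * t) * cosh (dist x (c 0))"
proof -
  define b r where "b = ray_busemann c x" and "r = dist x (c 0)"
  define \<Delta> where "\<Delta> = dist x (c t) - t - b"
  have b: "b \<ge> - r"
    using ray_busemann_lipschitz[OF c, of "c 0" x] ray_busemann_along[OF c order.refl]
    by (simp add: b_def r_def dist_commute)
  have "exp (b + \<Delta>) * exp t = exp (dist x (c t))"
    by (simp add: \<Delta>_def flip: exp_add)
  also have "\<dots> \<le> 2 * cosh (dist x (c t))" by (simp add: cosh_field_def)
  also have "\<dots> \<le> 2 * (exp (- t) * cosh r + sinh t * exp b)"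
    using cosh_dist_ray_le[OF c t, of x] by (simp add: b_def r_def)
  also have "\<dots> \<le> 2 * exp (- t) * cosh r + exp t * exp b"
    by (simp add: sinh_field_def algebra_simps)
  finally have "exp (b + \<Delta>) * exp t * exp (- b - t) \<le> (2 * exp (- t) * cosh r + exp t * exp b) * exp (- b - t)"
    by (intro mult_right_mono) auto
  then have "exp \<Delta> \<le> 2 * exp (- b - 2 * t) * cosh r + 1"
    by (simp add: algebra_simps flip: exp_add)
  also have "exp (- b - 2 * t) \<le> exp (r - 2 * t)" using b by simp
  finally have "exp \<Delta> \<le> 2 * exp (r - 2 * t) * cosh r + 1" by simp
  then have "\<Delta> \<le> 2 * exp (r - 2 * t) * cosh r" using exp_ge_add_one_self[of \<Delta>] by linarith
  then show ?thesis by (simp add: \<Delta>_def b_def r_def)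
qed

text \<open>A point of one ray at which the Busemann function of another ray from the same origin is
  almost as small as possible is close to the other ray.\<close>

lemma cosh_dist_rays_le:
  fixes c c' :: "real \<Rightarrow> 'a"
  assumes c: "c \<in> geodesic_rays" and c': "c' \<in> geodesic_rays" and 0: "c 0 = c' 0"
    and t: "0 \<le> t" and \<epsilon>: "0 \<le> \<epsilon>" and b: "ray_busemann c' (c t) \<le> - t + \<epsilon>"
  shows "cosh (dist (c t) (c' t)) \<le> exp \<epsilon>"
proof -
  have "dist (c t) (c' 0) = t" using geodesic_raysD[OF c t order.refl] 0 t by simp
  then have "cosh (dist (c t) (c' t)) \<le> exp (- t) * cosh t + sinh t * exp (ray_busemann c' (c t))"
    using cosh_dist_ray_le[OF c' t, of "c t"] by simp
  also have "\<dots> \<le> exp (- t) * cosh t * exp \<epsilon> + sinh t * exp (- t + \<epsilon>)"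
  proof (intro add_mono mult_left_mono)
    show "exp (- t) * cosh t \<le> exp (- t) * cosh t * exp \<epsilon>" using \<epsilon> by simp
    show "exp (ray_busemann c' (c t)) \<le> exp (- t + \<epsilon>)" using b by simp
  qed (use t in simp)
  also have "\<dots> = exp (- t) * exp \<epsilon> * (cosh t + sinh t)" by (simp add: exp_diff exp_minus field_simps)
  also have "\<dots> = exp \<epsilon>" by (simp add: cosh_plus_sinh flip: exp_add)
  finally show ?thesis .
qed

text \<open>In particular, a Busemann function determines its ray once the origin is given.\<close>

lemma rays_eqI_busemann:
  fixes c c' :: "real \<Rightarrow> 'a"
  assumes c: "c \<in> geodesic_rays" and c': "c' \<in> geodesic_rays" and 0: "c 0 = c' 0"
    and b: "\<And>t. 0 \<le> t \<Longrightarrow> ray_busemann c' (c t) \<le> - t"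
  shows "c = c'"
proof (rule extensionalityI)
  show "c \<in> extensional {0..}" "c' \<in> extensional {0..}"
    using c c' by (auto simp: geodesic_rays_def)
  fix t :: real assume "t \<in> {0..}"
  then have "cosh (dist (c t) (c' t)) \<le> cosh 0"
    using cosh_dist_rays_le[OF c c' 0, of t 0] b by simp
  then show "c t = c' t" using cosh_le_imp_le[of "dist (c t) (c' t)" 0] by simp
qed

text \<open>Along \<open>c\<close>, Stewart's inequality with apex \<open>c' T\<close> has a bounded contribution from the
  far endpoint \<open>c T\<close>, which stays close to the apex. For \<open>T \<longlonglongrightarrow> \<infinity>\<close> this shows that the Busemann
  function of \<open>c'\<close> decreases with unit speed along \<open>c\<close>, as it does along \<open>c'\<close>.\<close>

lemma asymptotic_rays_eq:
  fixes c c' :: "real \<Rightarrow> 'a"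
  assumes as: "(c, c') \<in> asymptotic_rel" and 0: "c 0 = c' 0"
  shows "c = c'"
proof -
  obtain K where c: "c \<in> geodesic_rays" and c': "c' \<in> geodesic_rays"
    and K: "\<And>t. t \<ge> 0 \<Longrightarrow> dist (c t) (c' t) \<le> K"
    using as by (auto simp: asymptotic_rel_def)
  have "K \<ge> 0" using K[of 0] 0 by simp
  show ?thesis
  proof (rule rays_eqI_busemann[OF c c' 0])
    fix t :: real assume t: "0 \<le> t"
    have "exp (ray_busemann c' (c t)) \<le> exp (- t) * exp 0 + sinh t * cosh K * 0"
    proof (rule tendsto_le)
      show "((\<lambda>T. cosh (dist (c t) (c' T)) / sinh T) \<longlongrightarrow> exp (ray_busemann c' (c t))) at_top"
        by (intro tendsto_cosh_div_sinh ray_busemann_tendsto c')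
      have "((\<lambda>T::real. 1 / (sinh T)\<^sup>2) \<longlongrightarrow> 0) at_top" by real_asymp
      then show "((\<lambda>T. exp (- t) * (cosh T / sinh T) + sinh t * cosh K * (1 / (sinh T)\<^sup>2)) \<longlongrightarrow>
          exp (- t) * exp 0 + sinh t * cosh K * 0) at_top"
        by (intro tendsto_intros tendsto_cosh_div_sinh) auto
      show "\<forall>\<^sub>F T in at_top. cosh (dist (c t) (c' T)) / sinh T \<le>
          exp (- t) * (cosh T / sinh T) + sinh t * cosh K * (1 / (sinh T)\<^sup>2)"
        using eventually_gt_at_top[of t]
      proof eventually_elim
        case (elim T)
        have T: "sinh T > 0" "dist (c 0) (c T) = T" "dist (c' T) (c 0) = T"
          using elim t geodesic_raysD[OF c order.refl, of T] geodesic_raysD[OF c', of T 0] 0 by auto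
        have "cosh (dist (c' T) (c t)) * sinh T
           \<le> sinh (T - t) * cosh T + sinh t * cosh (dist (c' T) (c T))"
          using stewart[OF geodesic_ray_segment[OF c], of T t "c' T"] T(2,3) t elim by simp
        also have "\<dots> \<le> exp (- t) * sinh T * cosh T + sinh t * cosh K"
          using sinh_diff_le[OF t, of T] K[of T] \<open>K \<ge> 0\<close> elim t
          by (intro add_mono mult_right_mono mult_left_mono) (auto simp: cosh_real_nonneg_le_iff dist_commute)
        finally have "cosh (dist (c' T) (c t)) * sinh T / (sinh T)\<^sup>2
            \<le> (exp (- t) * sinh T * cosh T + sinh t * cosh K) / (sinh T)\<^sup>2"
          by (intro divide_right_mono) auto
        then show ?case using T(1) by (simp add: power2_eq_square add_divide_distrib dist_commute)
      qed
    qed simp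
    then show "ray_busemann c' (c t) \<le> - t" by simp
  qed
qed

end

section \<open>Rays from the base point in a given direction\<close>

locale proper_CAT_neg1 = CAT_neg1 x\<^sub>0 for x\<^sub>0 :: "'a::metric_space" +
  assumes proper: "proper_space TYPE('a)"
begin

lemma Cauchy_imp_convergent:
  assumes "Cauchy (f :: nat \<Rightarrow> 'a)"
  shows "convergent f"
proof -
  obtain r where r: "\<forall>y\<in>range f. dist x\<^sub>0 y \<le> r"
    using cauchy_imp_bounded[OF assms] bounded_any_center[of "range f" x\<^sub>0] by blast
  have "complete (cball x\<^sub>0 r)"
    using proper by (auto simp: proper_space_def intro: compact_imp_complete)
  moreover have "f n \<in> cball x\<^sub>0 r" for n using r by simp
  ultimately obtain l where "f \<longlonglongrightarrow> l" using assms by (meson completeE)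
  then show ?thesis by (rule convergentI)
qed

text \<open>The ray is the limit of the segments from the base point to the points \<open>c n\<close>. Stewart's
  inequality gives both the convergence of the segments and a bound for their distance to \<open>c\<close>
  that does not depend on \<open>n\<close>.\<close>

lemma asymptotic_ray_exists:
  fixes c :: "real \<Rightarrow> 'a"
  assumes c: "c \<in> geodesic_rays"
  obtains c' where "c' \<in> geodesic_rays" "c' 0 = x\<^sub>0" "(c, c') \<in> asymptotic_rel"
proof -
  define K where "K = dist x\<^sub>0 (c 0)"
  define a where "a n = dist x\<^sub>0 (c (real n))" for n
  have a: "a n \<le> n + K" "n - K \<le> a n" for n
    using geodesic_raysD[OF c, of 0 n] dist_triangle[of x\<^sub>0 "c n" "c 0"]
      dist_triangle3[of "c 0" "c n" x\<^sub>0]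
    by (auto simp: a_def K_def)
  have "\<exists>\<sigma>. geodesic_segment x\<^sub>0 (c (real n)) \<sigma>" for n
    using CAT unfolding CAT_neg1_space_def by metis
  then obtain \<sigma> where \<sigma>: "geodesic_segment x\<^sub>0 (c (real n)) (\<sigma> n)" for n by metis
  have \<sigma>0: "\<sigma> n 0 = x\<^sub>0" for n using \<sigma> by (auto simp: geodesic_segment_def)
  have \<sigma>d: "dist (\<sigma> n s) (\<sigma> n t) = \<bar>s - t\<bar>" if "0 \<le> s" "0 \<le> t" "s \<le> a n" "t \<le> a n" for n s t
    using \<sigma>[of n] that by (auto simp: geodesic_segment_def a_def)
  \<comment> \<open>The endpoints of \<open>\<sigma> n\<close> and \<open>\<sigma> m\<close> are no further apart than the lengths differ, up to
      \<open>2 * K\<close>. Therefore Stewart's inequality along \<open>\<sigma> m\<close> shows that the distance \<open>D\<close> below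
      is hardly greater than \<open>a n - t\<close>, its least possible value. With this, the inequality
      along \<open>\<sigma> n\<close> shows that the points at time \<open>t\<close> are exponentially close.\<close>
  have close: "cosh (dist (\<sigma> m t) (\<sigma> n t)) \<le> 1 + (1 + 4 * sinh t) * exp (K - n)"
    if t: "t \<ge> 0" and n: "n \<ge> K + 1 + t" and mn: "m \<ge> n" for m n :: nat and t
  proof -
    define A B where "A = sinh (a n)" and "B = sinh (a m)"
    have an: "a n \<ge> 1 + t" and am: "a m \<ge> 1 + t"
      using a(2)[of n] a(2)[of m] n mn by linarith+
    have AB: "A > 0" "B > 0" using an am t by (auto simp: A_def B_def)
    define D where "D = dist (c n) (\<sigma> m t)"
    have "cosh D * B \<le> sinh (a m - t) * cosh (a n) + sinh t * cosh (real m - n)"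
      using stewart[OF \<sigma>[of m], of t "c n"] am t mn geodesic_raysD[OF c, of n m]
      by (simp add: D_def B_def a_def dist_commute)
    also have "\<dots> \<le> exp (- t) * B * cosh (a n) + sinh t * (4 * exp (K - n) * B)"
    proof (intro add_mono mult_right_mono mult_left_mono)
      show "sinh (a m - t) \<le> exp (- t) * B" unfolding B_def by (rule sinh_diff_le[OF t])
      have "cosh (real m - n) \<le> exp (real m - n)" using mn by (intro cosh_le_exp) simp
      also have "\<dots> \<le> exp (K - n + a m)" using a(2)[of m] by simp
      also have "\<dots> = exp (K - n) * exp (a m)" by (rule exp_add)
      also have "\<dots> \<le> exp (K - n) * (4 * B)"
        unfolding B_def using am t by (intro mult_left_mono sinh_ge_exp) auto
      finally show "cosh (real m - n) \<le> 4 * exp (K - n) * B" by simp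
    qed (use t in auto)
    also have "\<dots> = (exp (- t) * cosh (a n) + sinh t * (4 * exp (K - n))) * B"
      by (simp add: algebra_simps)
    finally have D: "cosh D \<le> exp (- t) * cosh (a n) + sinh t * (4 * exp (K - n))"
      using AB by simp
    have cA: "cosh (a n) = A + exp (- a n)" by (simp add: A_def cosh_field_def sinh_field_def field_simps)
    have "cosh (dist (\<sigma> m t) (\<sigma> n t)) * A \<le> sinh (a n - t) * cosh t + sinh t * cosh D"
      using stewart[OF \<sigma>[of n], of t "\<sigma> m t"] an t \<sigma>d[of 0 t m] am \<sigma>0
      by (simp add: A_def D_def a_def dist_commute)
    also have "\<dots> \<le> exp (- t) * A * cosh t +
        sinh t * (exp (- t) * cosh (a n) + sinh t * (4 * exp (K - n)))"
      using D t sinh_diff_le[OF t, of "a n"] by (intro add_mono mult_right_mono mult_left_mono) (auto simp: A_def)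
    also have "\<dots> = exp (- t) * (cosh t + sinh t) * A +
        sinh t * (exp (- t - a n) + 4 * sinh t * exp (K - n))"
      unfolding cA by (simp add: algebra_simps flip: exp_add)
    also have "exp (- t) * (cosh t + sinh t) = 1" by (simp add: cosh_plus_sinh flip: exp_add)
    also have "sinh t * (exp (- t - a n) + 4 * sinh t * exp (K - n))
       \<le> A * (exp (K - n) + 4 * sinh t * exp (K - n))"
    proof (intro mult_mono add_right_mono)
      show "sinh t \<le> A" using an by (simp add: A_def)
      show "exp (- t - a n) \<le> exp (K - n)" using a(2)[of n] t by simp
    qed (use t AB in auto)
    finally have "cosh (dist (\<sigma> m t) (\<sigma> n t)) * A \<le> (1 + (1 + 4 * sinh t) * exp (K - n)) * A"
      by (simp add: algebra_simps)
    then show ?thesis using AB by simp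
  qed
  have "convergent (\<lambda>n. \<sigma> n t)" if t: "t \<ge> 0" for t
  proof (rule Cauchy_imp_convergent, rule metric_CauchyI)
    fix e :: real assume e: "e > 0"
    have "((\<lambda>n::nat. 1 + (1 + 4 * sinh t) * exp (K - n)) \<longlongrightarrow> 1 + (1 + 4 * sinh t) * 0) sequentially"
      by (intro tendsto_intros) real_asymp
    moreover have "1 < cosh e" using cosh_real_nonneg_less_iff[of 0 e] e by simp
    ultimately have "\<forall>\<^sub>F n in sequentially. 1 + (1 + 4 * sinh t) * exp (K - real n) < cosh e"
      by (intro order_tendstoD) auto
    moreover have "\<forall>\<^sub>F n in sequentially. real n \<ge> K + 1 + t" by real_asymp
    ultimately have "\<forall>\<^sub>F n in sequentially.
       1 + (1 + 4 * sinh t) * exp (K - real n) < cosh e \<and> real n \<ge> K + 1 + t"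
      by (rule eventually_conj)
    then obtain N where N: "\<And>n. n \<ge> N \<Longrightarrow>
       1 + (1 + 4 * sinh t) * exp (K - real n) < cosh e \<and> real n \<ge> K + 1 + t"
      unfolding eventually_sequentially by blast
    have le: "dist (\<sigma> m t) (\<sigma> n t) < e" if "n \<ge> N" "m \<ge> n" for m n
    proof -
      have "cosh (dist (\<sigma> m t) (\<sigma> n t)) < cosh e"
        using close[OF t, of n m] N[of n] that by force
      then show ?thesis using e by (simp add: cosh_real_nonneg_less_iff)
    qed
    have "dist (\<sigma> m t) (\<sigma> n t) < e" if "m \<ge> N" "n \<ge> N" for m n
      using le[of n m] le[of m n] that by (cases "n \<le> m") (auto simp: dist_commute)
    then show "\<exists>N. \<forall>m\<ge>N. \<forall>n\<ge>N. dist (\<sigma> m t) (\<sigma> n t) < e" by blast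
  qed
  then have lim: "(\<lambda>n. \<sigma> n t) \<longlonglongrightarrow> lim (\<lambda>n. \<sigma> n t)" if "t \<ge> 0" for t
    using that convergent_LIMSEQ_iff by blast
  have ev: "\<forall>\<^sub>F n in sequentially. t \<le> a n" for t
  proof -
    have "\<forall>\<^sub>F n in sequentially. real n \<ge> K + t" by real_asymp
    then show ?thesis by eventually_elim (use a(2) in \<open>smt (verit)\<close>)
  qed
  define c' where "c' = restrict (\<lambda>t. lim (\<lambda>n. \<sigma> n t)) {0..}"
  have lim': "(\<lambda>n. \<sigma> n t) \<longlonglongrightarrow> c' t" if "t \<ge> 0" for t
    using lim[OF that] that by (simp add: c'_def)
  have "dist (c' s) (c' t) = \<bar>s - t\<bar>" if st: "s \<ge> 0" "t \<ge> 0" for s t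
  proof (rule LIMSEQ_unique)
    show "(\<lambda>n. dist (\<sigma> n s) (\<sigma> n t)) \<longlonglongrightarrow> dist (c' s) (c' t)"
      by (intro tendsto_dist lim' st)
    show "(\<lambda>n. dist (\<sigma> n s) (\<sigma> n t)) \<longlonglongrightarrow> \<bar>s - t\<bar>"
    proof (rule tendsto_eventually)
      show "\<forall>\<^sub>F n in sequentially. dist (\<sigma> n s) (\<sigma> n t) = \<bar>s - t\<bar>"
        using ev[of s] ev[of t] by eventually_elim (use \<sigma>d st in auto)
    qed
  qed
  then have c': "c' \<in> geodesic_rays" by (simp add: geodesic_rays_def c'_def)
  have 0: "c' 0 = x\<^sub>0"
    using lim'[of 0] by (simp add: \<sigma>0 LIMSEQ_const_iff)
  have "dist (c t) (c' t) \<le> 10 * exp K" if t: "t \<ge> 0" for t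
  proof (rule tendsto_upperbound)
    show "(\<lambda>n. dist (c t) (\<sigma> n t)) \<longlonglongrightarrow> dist (c t) (c' t)"
      by (intro tendsto_intros lim' t)
    have "\<forall>\<^sub>F n in sequentially. real n \<ge> t" by real_asymp
    with ev[of "1 + t"] show "\<forall>\<^sub>F n in sequentially. dist (c t) (\<sigma> n t) \<le> 10 * exp K"
    proof eventually_elim
      case (elim n)
      define d A where "d = dist (c t) (\<sigma> n t)" and "A = sinh (a n)"
      have A: "A > 0" using elim t by (simp add: A_def)
      have "cosh d * A \<le> sinh (a n - t) * cosh (dist (c t) x\<^sub>0) + sinh t * cosh (real n - t)"
        using stewart[OF \<sigma>[of n], of t "c t"] elim t geodesic_raysD[OF c, of t n]
        by (simp add: d_def A_def a_def dist_commute cosh_minus[of "real n - t", symmetric] del: cosh_minus)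
      also have "\<dots> \<le> exp (- t) * A * exp (t + K) + exp t * exp (real n - t)"
      proof (intro add_mono mult_mono)
        show "sinh (a n - t) \<le> exp (- t) * A" unfolding A_def by (rule sinh_diff_le[OF t])
        have "dist (c t) x\<^sub>0 \<le> t + K"
          using dist_triangle[of "c t" x\<^sub>0 "c 0"] geodesic_raysD[OF c t order.refl] t
          by (simp add: K_def dist_commute)
        then show "cosh (dist (c t) x\<^sub>0) \<le> exp (t + K)"
          using cosh_le_exp[of "dist (c t) x\<^sub>0"] by (meson exp_le_cancel_iff order_trans zero_le_dist)
        show "sinh t \<le> exp t" using cosh_real_pos[of t] cosh_plus_sinh[of t] by linarith
        show "cosh (real n - t) \<le> exp (real n - t)" using elim by (intro cosh_le_exp) simp
      qed (use A t in auto)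
      also have "\<dots> = exp K * A + exp (real n)" by (simp add: mult.commute mult.left_commute flip: exp_add)
      also have "exp (real n) \<le> exp (K + a n)" using a(2)[of n] by simp
      also have "\<dots> \<le> exp K * (4 * A)"
        unfolding exp_add A_def using elim t by (intro mult_left_mono sinh_ge_exp) auto
      finally have "cosh d * A \<le> 5 * exp K * A" by (simp add: mult_ac)
      then have "cosh d \<le> 5 * exp K" using A by simp
      moreover have "exp d \<le> 2 * cosh d" by (simp add: cosh_field_def)
      ultimately show ?case using exp_ge_add_one_self[of d] unfolding d_def by linarith
    qed
  qed simp
  then have "(c, c') \<in> asymptotic_rel" using c c' by (auto simp: asymptotic_rel_def)
  with c' 0 show thesis by (rule that)
qed

end

section \<open>Classes of rays and of functions modulo constants\<close>

lemma equiv_asymptotic_rel: "equiv geodesic_rays (asymptotic_rel :: ((real \<Rightarrow> 'a::metric_space) \<times> _) set)"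
proof (rule equivI)
  show "asymptotic_rel \<subseteq> geodesic_rays \<times> (geodesic_rays :: (real \<Rightarrow> 'a) set)"
    by (auto simp: asymptotic_rel_def)
  show "refl_on geodesic_rays (asymptotic_rel :: ((real \<Rightarrow> 'a) \<times> _) set)"
    by (auto simp: asymptotic_rel_def refl_on_def)
  show "sym (asymptotic_rel :: ((real \<Rightarrow> 'a) \<times> _) set)"
    by (auto simp: asymptotic_rel_def sym_def dist_commute)
  show "trans (asymptotic_rel :: ((real \<Rightarrow> 'a) \<times> _) set)"
  proof (rule transI)
    fix c1 c2 c3 :: "real \<Rightarrow> 'a"
    assume "(c1, c2) \<in> asymptotic_rel" "(c2, c3) \<in> asymptotic_rel"
    then obtain K L where "c1 \<in> geodesic_rays" "c3 \<in> geodesic_rays"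
      and K: "\<forall>t\<ge>0. dist (c1 t) (c2 t) \<le> K" and L: "\<forall>t\<ge>0. dist (c2 t) (c3 t) \<le> L"
      by (auto simp: asymptotic_rel_def)
    moreover have "\<forall>t\<ge>0. dist (c1 t) (c3 t) \<le> K + L"
      using K L dist_triangle by (metis add_mono order_trans)
    ultimately show "(c1, c3) \<in> asymptotic_rel" by (auto simp: asymptotic_rel_def)
  qed
qed

abbreviation endpoint :: "(real \<Rightarrow> 'a::metric_space) \<Rightarrow> (real \<Rightarrow> 'a) set" where
  "endpoint c \<equiv> asymptotic_rel `` {c}"

lemma mod_const_class_iff:
  assumes "continuous_on UNIV f"
  shows "g \<in> mod_const_class f \<longleftrightarrow> continuous_on UNIV g \<and> (\<exists>k. \<forall>w. g w = f w + k)"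
  using assms by (auto simp: mod_const_class_def mod_const_rel_def)

lemma equiv_mod_const_rel:
  "equiv {f :: 'a::metric_space \<times> 'a \<Rightarrow> real. continuous_on UNIV f} mod_const_rel"
proof (rule equivI)
  let ?R = "mod_const_rel :: (('a \<times> 'a \<Rightarrow> real) \<times> _) set"
  show "?R \<subseteq> {f. continuous_on UNIV f} \<times> {f. continuous_on UNIV f}"
    by (auto simp: mod_const_rel_def)
  show "refl_on {f. continuous_on UNIV f} ?R"
    by (auto simp: mod_const_rel_def refl_on_def intro: exI[of _ 0])
  show "sym ?R"
  proof (rule symI)
    fix f g assume "(f, g) \<in> ?R"
    then obtain k where "continuous_on UNIV f" "continuous_on UNIV g" "\<forall>w. g w = f w + k"
      unfolding mod_const_rel_def by blast
    moreover from this have "\<forall>w. f w = g w + (- k)" by simp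
    ultimately show "(g, f) \<in> ?R" unfolding mod_const_rel_def by blast
  qed
  show "trans ?R"
  proof (rule transI)
    fix f g h assume "(f, g) \<in> ?R" "(g, h) \<in> ?R"
    then obtain k l where "continuous_on UNIV f" "continuous_on UNIV h"
      "\<forall>w. g w = f w + k" "\<forall>w. h w = g w + l" unfolding mod_const_rel_def by blast
    moreover from this have "\<forall>w. h w = f w + (k + l)" by simp
    ultimately show "(f, h) \<in> ?R" unfolding mod_const_rel_def by blast
  qed
qed

lemma mod_const_class_self: "continuous_on UNIV f \<Longrightarrow> f \<in> mod_const_class f"
  by (simp add: mod_const_class_iff exI[of _ 0])

lemma mod_const_class_eqI:
  "continuous_on UNIV f \<Longrightarrow> g \<in> mod_const_class f \<Longrightarrow> mod_const_class g = mod_const_class f"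
  unfolding mod_const_class_def using equiv_class_eq[OF equiv_mod_const_rel, of f g] by blast

lemma openin_Cstar:
  "openin Cstar V \<longleftrightarrow> V \<subseteq> {f. continuous_on UNIV f} // mod_const_rel \<and>
     (\<forall>f. continuous_on UNIV f \<and> mod_const_class f \<in> V \<longrightarrow>
       (\<exists>K e. compact K \<and> e > 0 \<and> (\<forall>g. continuous_on UNIV g \<longrightarrow> (\<forall>w\<in>K. dist (f w) (g w) < e)
          \<longrightarrow> mod_const_class g \<in> V)))"
  unfolding Cstar_def openin_final_topology openin_ucc_topology by auto

lemma topspace_Cstar: "topspace Cstar = {f. continuous_on UNIV f} // mod_const_rel"
  unfolding Cstar_def
  by (rule topspace_final_topology) (auto simp: mod_const_class_def intro: quotientI)

lemma mod_const_class_in_Cstar: "continuous_on UNIV f \<Longrightarrow> mod_const_class f \<in> topspace Cstar"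
  unfolding topspace_Cstar mod_const_class_def by (auto intro: quotientI)

section \<open>Busemann functions depending on one factor\<close>

text \<open>The two factors are indexed by \<open>1\<close> and \<open>2\<close>, as are the two copies of the ideal boundary,
  so that both cases are treated at once. The factor other than \<open>i\<close> has index \<open>3 - i\<close>.\<close>

definition factor :: "nat \<Rightarrow> 'a \<times> 'a \<Rightarrow> 'a" where
  "factor i w = (if i = 1 then fst w else snd w)"

definition embed_factor :: "nat \<Rightarrow> 'a \<Rightarrow> 'a \<Rightarrow> 'a \<times> 'a" where
  "embed_factor i o' x = (if i = 1 then (x, o') else (o', x))"

lemma factor_embed [simp]: "factor i (embed_factor i o' x) = x"
  by (simp add: factor_def embed_factor_def)

lemma factor_embed_other: "i \<in> {1, 2} \<Longrightarrow> j \<in> {1, 2} \<Longrightarrow> i \<noteq> j \<Longrightarrow> factor j (embed_factor i o' x) = o'"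
  by (auto simp: factor_def embed_factor_def)

lemma factor_diagonal [simp]: "factor i (x, x) = x"
  by (simp add: factor_def)

lemma dmax_embed: "dmax (embed_factor i o' x) w = max (dist x (factor i w)) (dist o' (factor (3 - i) w))"
  if "i \<in> {1, 2}"
  using that by (cases w) (auto simp: dmax_def embed_factor_def factor_def max.commute)

lemma continuous_factor: "continuous_on UNIV (factor i :: 'a::topological_space \<times> 'a \<Rightarrow> 'a)"
  by (cases "i = 1") (auto simp: factor_def[abs_def] intro!: continuous_intros)

lemma continuous_dmax: "continuous_on UNIV (dmax w)"
  by (cases w) (auto simp: dmax_def case_prod_beta intro!: continuous_intros)

definition factor_class :: "nat \<Rightarrow> (real \<Rightarrow> 'a::metric_space) \<Rightarrow> ('a \<times> 'a \<Rightarrow> real) set" where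
  "factor_class i c = mod_const_class (\<lambda>w. ray_busemann c (factor i w))"

lemma continuous_busemann_factor:
  assumes "c \<in> geodesic_rays"
  shows "continuous_on UNIV (\<lambda>w. ray_busemann c (factor i w))"
  by (rule continuous_on_compose2[OF continuous_ray_busemann[OF assms] continuous_factor]) simp

context proper_CAT_neg1
begin

definition rays :: "(real \<Rightarrow> 'a) set" where
  "rays = {c \<in> geodesic_rays. c 0 = x\<^sub>0}"

lemma raysD: "c \<in> rays \<Longrightarrow> c \<in> geodesic_rays" "c \<in> rays \<Longrightarrow> c 0 = x\<^sub>0"
  by (auto simp: rays_def)

lemma endpoint_in: "c \<in> rays \<Longrightarrow> endpoint c \<in> ideal_boundary"
  by (auto simp: ideal_boundary_def rays_def intro: quotientI)

lemma ray_in_endpoint: "c \<in> rays \<Longrightarrow> c \<in> endpoint c"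
  using equiv_class_self[OF equiv_asymptotic_rel] by (auto simp: rays_def)

lemma endpoint_inj: "c \<in> rays \<Longrightarrow> c' \<in> rays \<Longrightarrow> endpoint c = endpoint c' \<Longrightarrow> c = c'"
  using asymptotic_rays_eq[of c c'] ray_in_endpoint[of c'] raysD(2) by (metis Image_singleton_iff)

lemma ideal_boundaryE:
  assumes "\<xi> \<in> (ideal_boundary :: (real \<Rightarrow> 'a) set set)"
  obtains c where "c \<in> rays" "\<xi> = endpoint c"
proof -
  obtain c0 :: "real \<Rightarrow> 'a" where c0: "c0 \<in> geodesic_rays" "\<xi> = endpoint c0"
    using assms unfolding ideal_boundary_def by (rule quotientE)
  obtain c where c: "c \<in> geodesic_rays" "c 0 = x\<^sub>0" "(c0, c) \<in> asymptotic_rel"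
    using asymptotic_ray_exists[OF c0(1)] .
  show thesis
    using that[of c] c c0(2) equiv_class_eq[OF equiv_asymptotic_rel c(3)] by (simp add: rays_def)
qed

lemma busemann_endpoint:
  assumes c: "c \<in> rays"
  shows "busemann x\<^sub>0 (endpoint c) = ray_busemann c"
proof -
  have "(THE c'. c' \<in> endpoint c \<and> c' 0 = x\<^sub>0) = c"
  proof (rule the_equality)
    show "c \<in> endpoint c \<and> c 0 = x\<^sub>0" using ray_in_endpoint[OF c] raysD(2)[OF c] ..
    show "c' = c" if "c' \<in> endpoint c \<and> c' 0 = x\<^sub>0" for c'
      using that asymptotic_rays_eq[of c c'] raysD(2)[OF c] by simp
  qed
  then show ?thesis by (simp add: fun_eq_iff busemann_def ray_busemann_def)
qed

lemma busemann_base: "c \<in> rays \<Longrightarrow> ray_busemann c x\<^sub>0 = 0"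
  using ray_busemann_along[of c 0] raysD[of c] by simp

text \<open>The time \<open>t\<close> can be chosen for all rays from the base point at once.\<close>

lemma busemann_uniform_approx:
  assumes "e > 0"
  obtains t where "t \<ge> t\<^sub>0" "t \<ge> 0" and
    "\<And>c x. c \<in> rays \<Longrightarrow> dist x\<^sub>0 x \<le> r \<Longrightarrow>
       0 \<le> dist x (c t) - t - ray_busemann c x \<and> dist x (c t) - t - ray_busemann c x < e"
proof -
  have "((\<lambda>t. 2 * exp (r - 2 * t) * cosh r) \<longlongrightarrow> 2 * 0 * cosh r) at_top"
    by (intro tendsto_intros) real_asymp
  then have "\<forall>\<^sub>F t in at_top. 2 * exp (r - 2 * t) * cosh r < e"
    using assms by (intro order_tendstoD) auto
  with eventually_ge_at_top[of "max t\<^sub>0 0"] have "\<forall>\<^sub>F t in at_top. t \<ge> max t\<^sub>0 0 \<and> 2 * exp (r - 2 * t) * cosh r < e"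
    by (rule eventually_conj)
  then obtain t where t: "t \<ge> max t\<^sub>0 0" "2 * exp (r - 2 * t) * cosh r < e"
    using eventually_happens'[OF trivial_limit_at_top_linorder] by blast
  show thesis
  proof (rule that[of t])
    fix c x assume c: "c \<in> rays" and x: "dist x\<^sub>0 x \<le> r"
    have "dist x (c t) - t - ray_busemann c x \<le> 2 * exp (dist x x\<^sub>0 - 2 * t) * cosh (dist x x\<^sub>0)"
      using ray_busemann_approx[of c t x] raysD[OF c] t(1) by simp
    also have "\<dots> \<le> 2 * exp (r - 2 * t) * cosh r"
    proof (intro mult_mono)
      have "0 \<le> r" using x zero_le_dist[of x\<^sub>0 x] by linarith
      then show "cosh (dist x x\<^sub>0) \<le> cosh r"
        using x by (simp add: cosh_real_nonneg_le_iff dist_commute)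
    qed (use x in \<open>auto simp: dist_commute\<close>)
    finally show "0 \<le> dist x (c t) - t - ray_busemann c x \<and> dist x (c t) - t - ray_busemann c x < e"
      using t ray_busemann_le[of c t x] raysD[OF c] by simp
  qed (use t in auto)
qed

text \<open>Both functions vanish at \<open>(x\<^sub>0, x\<^sub>0)\<close>, which fixes the additive constant. Two functions of
  different factors are told apart on the axis of one factor, where the function of the other
  factor is constant. For functions of the same factor, a Busemann function determines its ray.\<close>

lemma factor_class_inj:
  assumes c: "c \<in> rays" and c': "c' \<in> rays" and ij: "i \<in> {1, 2}" "j \<in> {1, 2}"
    and mem: "(\<lambda>w. ray_busemann c (factor i w)) \<in> factor_class j c'"
  shows "i = j \<and> c = c'"
proof -
  obtain k where k: "\<And>w. ray_busemann c (factor i w) = ray_busemann c' (factor j w) + k"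
    using mem continuous_busemann_factor[OF raysD(1)[OF c']]
    by (auto simp: factor_class_def mod_const_class_iff)
  have "k = 0" using k[of "(x\<^sub>0, x\<^sub>0)"] c c' by (simp add: busemann_base)
  have "i = j"
  proof (rule ccontr)
    assume "i \<noteq> j"
    then have "ray_busemann c x\<^sub>0 = ray_busemann c' (c' 1)"
      using k[of "embed_factor j x\<^sub>0 (c' 1)"] ij \<open>k = 0\<close> by (simp add: factor_embed_other)
    then show False using c c' by (simp add: busemann_base ray_busemann_along raysD)
  qed
  moreover have "c = c'"
  proof (rule rays_eqI_busemann)
    fix t :: real assume "0 \<le> t"
    then show "ray_busemann c' (c t) \<le> - t"
      using k[of "embed_factor i x\<^sub>0 (c t)"] \<open>i = j\<close> \<open>k = 0\<close> c by (simp add: ray_busemann_along raysD)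
  qed (use c c' in \<open>auto simp: raysD\<close>)
  ultimately show ?thesis ..
qed

lemma compact_factor_bounded:
  assumes "compact (K :: ('a \<times> 'a) set)"
  shows "\<exists>r. \<forall>w\<in>K. \<forall>i. dist x\<^sub>0 (factor i w) \<le> r"
proof -
  obtain r where r: "\<forall>w\<in>K. dist (x\<^sub>0, x\<^sub>0) w \<le> r"
    using compact_imp_bounded[OF assms] bounded_any_center[of K "(x\<^sub>0, x\<^sub>0)"] by blast
  have "dist x\<^sub>0 (factor i w) \<le> dist (x\<^sub>0, x\<^sub>0) w" for i w
    using dist_fst_le[of "(x\<^sub>0, x\<^sub>0)" w] dist_snd_le[of "(x\<^sub>0, x\<^sub>0)" w] by (simp add: factor_def)
  with r show ?thesis by (meson order_trans)
qed

text \<open>The class is the limit of the points that run along \<open>c\<close> in the factor \<open>i\<close> and stay at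
  \<open>x\<^sub>0\<close> in the other factor: on a compact set, the distance in the factor \<open>i\<close> eventually exceeds
  the distance in the other one, so the maximum is attained there. The class is not that of a
  point because distance functions are bounded below, while a Busemann function is not.\<close>

lemma factor_class_in_max_boundary:
  assumes c: "c \<in> rays" and i: "i \<in> {1, 2}"
  shows "factor_class i c \<in> max_boundary"
proof -
  let ?f = "\<lambda>w. ray_busemann c (factor i w)"
  have cont: "continuous_on UNIV ?f" by (rule continuous_busemann_factor[OF raysD(1)[OF c]])
  have "\<exists>w. iota_max w \<in> V" if V: "openin Cstar V" "factor_class i c \<in> V" for V
  proof -
    obtain K e where K: "compact K" "e > 0" and V':
      "\<And>g. continuous_on UNIV g \<Longrightarrow> \<forall>w\<in>K. dist (?f w) (g w) < e \<Longrightarrow> mod_const_class g \<in> V"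
      using V cont unfolding openin_Cstar factor_class_def by blast
    obtain r where r: "\<And>i w. w \<in> K \<Longrightarrow> dist x\<^sub>0 (factor i w) \<le> r"
      using compact_factor_bounded[OF K(1)] by blast
    \<comment> \<open>From time \<open>2 * r\<close> on, the point of the ray is at distance at least \<open>r\<close> from the
        coordinate \<open>i\<close> of any point of \<open>K\<close>, and \<open>x\<^sub>0\<close> is at distance at most \<open>r\<close> from the other.\<close>
    obtain t where t: "t \<ge> 2 * r" "t \<ge> 0" and
      approx: "\<And>x. dist x\<^sub>0 x \<le> r \<Longrightarrow>
       0 \<le> dist x (c t) - t - ray_busemann c x \<and> dist x (c t) - t - ray_busemann c x < e"
      using busemann_uniform_approx[OF K(2), of "2 * r" r] c by metis
    let ?g = "\<lambda>w. dmax (embed_factor i x\<^sub>0 (c t)) w - t"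
    have cont_g: "continuous_on UNIV ?g"
      by (intro continuous_intros continuous_dmax)
    have "dist (?f w) (?g w) < e" if w: "w \<in> K" for w
    proof -
      have "dist x\<^sub>0 (c t) = t" using geodesic_raysD[OF raysD(1)[OF c], of 0 t] raysD(2)[OF c] t by simp
      then have "dist x\<^sub>0 (factor (3 - i) w) \<le> dist (c t) (factor i w)"
        using r[OF w, of i] r[OF w, of "3 - i"] t(1) dist_triangle2[of x\<^sub>0 "c t" "factor i w"] by linarith
      then have "?g w = dist (c t) (factor i w) - t" by (simp add: dmax_embed[OF i])
      then show ?thesis using approx[OF r[OF w, of i]] by (simp add: dist_real_def dist_commute)
    qed
    then have "mod_const_class ?g \<in> V" using V'[OF cont_g] by blast
    moreover have "mod_const_class ?g = iota_max (embed_factor i x\<^sub>0 (c t))"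
      unfolding iota_max_def
      by (rule mod_const_class_eqI) (auto simp: mod_const_class_iff continuous_dmax cont_g intro!: exI[of _ "- t"])
    ultimately show ?thesis by metis
  qed
  then have "factor_class i c \<in> max_compactification"
    unfolding max_compactification_def in_closure_of
    using mod_const_class_in_Cstar[OF cont] by (auto simp: factor_class_def)
  moreover have "factor_class i c \<noteq> iota_max w" for w
  proof
    assume "factor_class i c = iota_max w"
    then have "?f \<in> mod_const_class (dmax w)"
      using mod_const_class_self[OF cont] by (simp add: factor_class_def iota_max_def)
    then obtain k where k: "\<And>v. ?f v = dmax w v + k"
      by (auto simp: mod_const_class_iff continuous_dmax)
    have "dmax w v \<ge> 0" for v by (cases w; cases v) (simp add: dmax_def le_max_iff_disj)
    moreover have "?f (embed_factor i x\<^sub>0 (c (\<bar>k\<bar> + 1))) = - (\<bar>k\<bar> + 1)"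
      using ray_busemann_along[OF raysD(1)[OF c], of "\<bar>k\<bar> + 1"] by simp
    ultimately show False using k[of "embed_factor i x\<^sub>0 (c (\<bar>k\<bar> + 1))"] by (smt (verit))
  qed
  ultimately show ?thesis by (auto simp: max_boundary_def)
qed

lemma busemann_fst: "c \<in> rays \<Longrightarrow> (\<lambda>(z, z'). busemann x\<^sub>0 (endpoint c) z) = (\<lambda>w. ray_busemann c (factor 1 w))"
  by (auto simp: factor_def busemann_endpoint)

lemma busemann_snd: "c \<in> rays \<Longrightarrow> (\<lambda>(z, z'). busemann x\<^sub>0 (endpoint c) z') = (\<lambda>w. ray_busemann c (factor 2 w))"
  by (auto simp: factor_def busemann_endpoint)

section \<open>The singular boundary\<close>

lemma ideal_boundary_eq: "ideal_boundary = endpoint ` rays"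
  using ideal_boundaryE endpoint_in by blast

lemma max_boundary_sing_subset: "max_boundary_sing x\<^sub>0 \<subseteq> topspace Cstar"
proof -
  have "max_boundary_sing x\<^sub>0 \<subseteq> max_compactification"
    unfolding max_boundary_sing_def max_boundary_def by blast
  also have "\<dots> \<subseteq> topspace Cstar"
    unfolding max_compactification_def by (rule closure_of_subset_topspace)
  finally show ?thesis .
qed

lemma max_boundary_sing_eq:
  "max_boundary_sing x\<^sub>0 = {factor_class i c | i c. i \<in> {1, 2} \<and> c \<in> rays}"
proof (intro equalityI subsetI)
  fix P assume PS: "P \<in> max_boundary_sing x\<^sub>0"
  then obtain i c where ic: "i \<in> {1, 2}" "c \<in> rays"
    and mem: "(\<lambda>w. ray_busemann c (factor i w)) \<in> P"
    unfolding max_boundary_sing_def ideal_boundary_eq by (auto simp: busemann_fst busemann_snd)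
  obtain f where "continuous_on UNIV f" "P = mod_const_class f"
    using subsetD[OF max_boundary_sing_subset PS]
    unfolding topspace_Cstar mod_const_class_def by (auto elim: quotientE)
  then have "P = factor_class i c"
    using mod_const_class_eqI mem unfolding factor_class_def by blast
  then show "P \<in> {factor_class i c | i c. i \<in> {1, 2} \<and> c \<in> rays}" using ic by blast
next
  fix P assume "P \<in> {factor_class i c | i c. i \<in> {1, 2} \<and> c \<in> rays}"
  then obtain i c where P: "P = factor_class i c" and i: "i \<in> {1, 2}" and c: "c \<in> rays" by blast
  have "(\<lambda>w. ray_busemann c (factor i w)) \<in> P"
    unfolding P factor_class_def by (intro mod_const_class_self continuous_busemann_factor raysD(1) c)
  then show "P \<in> max_boundary_sing x\<^sub>0"
    using i factor_class_in_max_boundary[OF c i] c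
    unfolding max_boundary_sing_def ideal_boundary_eq P by (auto simp: busemann_fst busemann_snd)
qed

lemma phi_sing_factor_class:
  assumes c: "c \<in> rays" and i: "i \<in> {1, 2}"
  shows "phi_sing x\<^sub>0 (factor_class i c) = (i, endpoint c)"
proof -
  let ?P = "\<lambda>q. (\<exists>\<xi>\<in>ideal_boundary. (\<lambda>(z, z'). busemann x\<^sub>0 \<xi> z) \<in> factor_class i c \<and> q = (1, \<xi>)) \<or>
     (\<exists>\<xi>'\<in>ideal_boundary. (\<lambda>(z, z'). busemann x\<^sub>0 \<xi>' z') \<in> factor_class i c \<and> q = (2, \<xi>'))"
  have eq: "?P q \<longleftrightarrow> (\<exists>j\<in>{1, 2}. \<exists>c'\<in>rays. (\<lambda>w. ray_busemann c' (factor j w)) \<in> factor_class i c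
      \<and> q = (j, endpoint c'))" for q :: "nat \<times> (real \<Rightarrow> 'a) set"
    unfolding ideal_boundary_eq by (auto simp: busemann_fst busemann_snd)
  have "(\<lambda>w. ray_busemann c (factor i w)) \<in> factor_class i c"
    unfolding factor_class_def by (intro mod_const_class_self continuous_busemann_factor raysD(1) c)
  then show ?thesis
    unfolding phi_sing_def eq
    by (intro the_equality) (use c i factor_class_inj in blast)+
qed

section \<open>Comparison of the topologies\<close>

lemma openin_ideal_boundary:
  "openin (ideal_boundary_topology x\<^sub>0) U \<longleftrightarrow> U \<subseteq> ideal_boundary \<and>
     (\<forall>c\<in>rays. endpoint c \<in> U \<longrightarrow> (\<exists>K e. compact K \<and> K \<subseteq> {0..} \<and> e > 0 \<and>
        (\<forall>c'\<in>rays. (\<forall>t\<in>K. dist (c t) (c' t) < e) \<longrightarrow> endpoint c' \<in> U)))"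
  unfolding ideal_boundary_topology_def openin_final_topology openin_ucc_topology rays_def[symmetric]
  by auto

lemma topspace_ideal_boundary: "topspace (ideal_boundary_topology x\<^sub>0) = ideal_boundary"
  unfolding ideal_boundary_topology_def
  by (rule topspace_final_topology, unfold topspace_ucc_topology rays_def[symmetric])
    (use endpoint_in in blast)

text \<open>This is the continuity of the map that sends a boundary point to its class. On a compact
  set, all Busemann functions are approximated uniformly by the distance to the point of the ray
  at one fixed time \<open>t\<close>, so rays that are close at time \<open>t\<close> have close Busemann functions.\<close>

lemma open_endpoints_factor_class:
  assumes V: "openin Cstar V"
  shows "openin (ideal_boundary_topology x\<^sub>0) {endpoint c | c. c \<in> rays \<and> factor_class i c \<in> V}"
  unfolding openin_ideal_boundary
proof (intro conjI ballI impI)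
  show "{endpoint c | c. c \<in> rays \<and> factor_class i c \<in> V} \<subseteq> ideal_boundary"
    by (auto intro: endpoint_in)
  fix c assume c: "c \<in> rays" and "endpoint c \<in> {endpoint c | c. c \<in> rays \<and> factor_class i c \<in> V}"
  then have cV: "factor_class i c \<in> V" using endpoint_inj by blast
  let ?f = "\<lambda>c w. ray_busemann c (factor i w)"
  obtain K e where K: "compact K" "e > 0" and V':
      "\<And>g. continuous_on UNIV g \<Longrightarrow> \<forall>w\<in>K. dist (?f c w) (g w) < e \<Longrightarrow> mod_const_class g \<in> V"
    using V cV continuous_busemann_factor[OF raysD(1)[OF c], of i]
    unfolding openin_Cstar factor_class_def by blast
  obtain r where r: "\<And>i w. w \<in> K \<Longrightarrow> dist x\<^sub>0 (factor i w) \<le> r"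
    using compact_factor_bounded[OF K(1)] by blast
  have "e / 2 > 0" using K by simp
  then obtain t where t: "t \<ge> 0" and
      approx: "\<And>c x. c \<in> rays \<Longrightarrow> dist x\<^sub>0 x \<le> r \<Longrightarrow>
       0 \<le> dist x (c t) - t - ray_busemann c x \<and> dist x (c t) - t - ray_busemann c x < e / 2"
    using busemann_uniform_approx[of "e / 2" 0 r] by metis
  show "\<exists>K e. compact K \<and> K \<subseteq> {0..} \<and> e > 0 \<and> (\<forall>c'\<in>rays. (\<forall>t\<in>K. dist (c t) (c' t) < e) \<longrightarrow>
      endpoint c' \<in> {endpoint c | c. c \<in> rays \<and> factor_class i c \<in> V})"
  proof (intro exI[of _ "{t}"] exI[of _ "e / 2"] conjI ballI impI)
    fix c' assume c': "c' \<in> rays" and near: "\<forall>s\<in>{t}. dist (c s) (c' s) < e / 2"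
    have "dist (?f c w) (?f c' w) < e" if w: "w \<in> K" for w
    proof -
      let ?x = "factor i w"
      have "\<bar>dist ?x (c t) - dist ?x (c' t)\<bar> < e / 2"
        using bspec[OF near, of t] dist_triangle[of ?x "c t" "c' t"] dist_triangle[of ?x "c' t" "c t"]
          dist_commute[of "c t" "c' t"] unfolding singleton_iff by linarith
      then show ?thesis
        using approx[OF c r[OF w, of i]] approx[OF c' r[OF w, of i]]
        unfolding dist_real_def by linarith
    qed
    then have "factor_class i c' \<in> V"
      using V'[OF continuous_busemann_factor[OF raysD(1)[OF c']], of i] unfolding factor_class_def by blast
    then show "endpoint c' \<in> {endpoint c | c. c \<in> rays \<and> factor_class i c \<in> V}" using c' by blast
  qed (use t K in auto)
qed

text \<open>These conditions compare the values of a function at two points, so they do not depend on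
  the additive constant. They supply the neighbourhoods in \<^const>\<open>Cstar\<close> that separate the two
  copies of the ideal boundary and control the ray.\<close>

definition below_at :: "nat \<Rightarrow> 'a \<Rightarrow> real \<Rightarrow> ('a \<times> 'a \<Rightarrow> real) set set" where
  "below_at i x a = {mod_const_class f | f. continuous_on UNIV f \<and> f (embed_factor i x\<^sub>0 x) < f (x\<^sub>0, x\<^sub>0) + a}"

lemma mod_const_class_below_at_iff:
  assumes f: "continuous_on UNIV f"
  shows "mod_const_class f \<in> below_at i x a \<longleftrightarrow> f (embed_factor i x\<^sub>0 x) < f (x\<^sub>0, x\<^sub>0) + a"
proof
  assume "mod_const_class f \<in> below_at i x a"
  then obtain g where g: "continuous_on UNIV g" "g (embed_factor i x\<^sub>0 x) < g (x\<^sub>0, x\<^sub>0) + a"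
    "mod_const_class f = mod_const_class g" by (auto simp: below_at_def)
  then obtain k where "\<And>w. f w = g w + k"
    using mod_const_class_self[OF f] mod_const_class_iff[OF g(1), of f] by auto
  then show "f (embed_factor i x\<^sub>0 x) < f (x\<^sub>0, x\<^sub>0) + a" using g by simp
qed (use f in \<open>auto simp: below_at_def\<close>)

lemma openin_below_at: "openin Cstar (below_at i x a)"
  unfolding openin_Cstar
proof (intro conjI allI impI)
  show "below_at i x a \<subseteq> {f. continuous_on UNIV f} // mod_const_rel"
    by (auto simp: below_at_def mod_const_class_def intro: quotientI)
  fix f :: "'a \<times> 'a \<Rightarrow> real" assume "continuous_on UNIV f \<and> mod_const_class f \<in> below_at i x a"
  then have lt: "f (embed_factor i x\<^sub>0 x) < f (x\<^sub>0, x\<^sub>0) + a"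
    using mod_const_class_below_at_iff by blast
  let ?e = "(f (x\<^sub>0, x\<^sub>0) + a - f (embed_factor i x\<^sub>0 x)) / 2"
  show "\<exists>K e. compact K \<and> e > 0 \<and> (\<forall>g. continuous_on UNIV g \<longrightarrow> (\<forall>w\<in>K. dist (f w) (g w) < e) \<longrightarrow>
     mod_const_class g \<in> below_at i x a)"
  proof (intro exI[of _ "{embed_factor i x\<^sub>0 x, (x\<^sub>0, x\<^sub>0)}"] exI[of _ ?e] conjI allI impI)
    fix g :: "'a \<times> 'a \<Rightarrow> real" assume "continuous_on UNIV g"
      and d: "\<forall>w\<in>{embed_factor i x\<^sub>0 x, (x\<^sub>0, x\<^sub>0)}. dist (f w) (g w) < ?e"
    moreover have "g (embed_factor i x\<^sub>0 x) < g (x\<^sub>0, x\<^sub>0) + a"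
      using d by (simp add: dist_real_def) argo
    ultimately show "mod_const_class g \<in> below_at i x a" by (simp add: mod_const_class_below_at_iff)
  qed (use lt in auto)
qed

text \<open>If the value at the point of \<open>c\<close> at time \<open>T\<close> is less than \<open>\<epsilon> - T\<close>, then the ray defining
  the function is close to \<open>c\<close> up to time \<open>T\<close>. A function of the other factor does not
  change along \<open>c\<close> and is excluded as soon as \<open>T \<ge> \<epsilon>\<close>.\<close>

lemma factor_class_nhd:
  assumes c: "c \<in> rays" and i: "i \<in> {1, 2}"
    and U: "openin (ideal_boundary_topology x\<^sub>0) U" "endpoint c \<in> U"
  obtains V where "openin Cstar V" "factor_class i c \<in> V"
    "\<And>j c'. j \<in> {1, 2} \<Longrightarrow> c' \<in> rays \<Longrightarrow> factor_class j c' \<in> V \<Longrightarrow> j = i \<and> endpoint c' \<in> U"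
proof -
  have "\<exists>K e. compact K \<and> K \<subseteq> {0..} \<and> e > 0 \<and>
      (\<forall>c'\<in>rays. (\<forall>t\<in>K. dist (c t) (c' t) < e) \<longrightarrow> endpoint c' \<in> U)"
    using conjunct2[OF iffD1[OF openin_ideal_boundary U(1)]] c U(2) by simp
  then obtain K e where K: "compact K" "K \<subseteq> {0..}" "e > 0" and
    U': "\<forall>c'\<in>rays. (\<forall>t\<in>K. dist (c t) (c' t) < e) \<longrightarrow> endpoint c' \<in> U"
    by (elim exE conjE)
  obtain T0 where T0: "\<And>t. t \<in> K \<Longrightarrow> t \<le> T0"
    using bounded_imp_bdd_above[OF compact_imp_bounded[OF K(1)]] unfolding bdd_above_def by blast
  \<comment> \<open>The estimate for two rays bounds the hyperbolic cosine of their distance by \<open>exp \<epsilon>\<close>,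
      which has to lie below \<open>cosh e\<close>.\<close>
  define \<epsilon> where "\<epsilon> = ln (cosh e) / 2"
  have "1 < cosh e" using cosh_real_nonneg_less_iff[of 0 e] K by simp
  then have \<epsilon>: "\<epsilon> > 0" "exp \<epsilon> < cosh e"
  proof -
    have "0 < ln (cosh e)" using \<open>1 < cosh e\<close> by (rule ln_gt_zero)
    then have "\<epsilon> < ln (cosh e)" by (simp add: \<epsilon>_def)
    then have "exp \<epsilon> < exp (ln (cosh e))" by (rule exp_less_mono)
    then show "exp \<epsilon> < cosh e" by simp
    show "\<epsilon> > 0" using \<open>0 < ln (cosh e)\<close> by (simp add: \<epsilon>_def)
  qed
  define T where "T = max T0 \<epsilon>"
  have T: "T \<ge> 0" "T \<ge> \<epsilon>" using \<epsilon> by (auto simp: T_def)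
  have iff: "factor_class j c' \<in> below_at i (c T) (\<epsilon> - T) \<longleftrightarrow>
      ray_busemann c' (factor j (embed_factor i x\<^sub>0 (c T))) < \<epsilon> - T" if "c' \<in> rays" for j c'
    using that by (simp add: factor_class_def mod_const_class_below_at_iff continuous_busemann_factor raysD busemann_base)
  show thesis
  proof
    show "openin Cstar (below_at i (c T) (\<epsilon> - T))" by (rule openin_below_at)
    show "factor_class i c \<in> below_at i (c T) (\<epsilon> - T)"
      using iff[OF c, of i] c \<epsilon> T by (simp add: ray_busemann_along raysD)
    fix j c' assume j: "j \<in> {1, 2}" and c': "c' \<in> rays"
      and "factor_class j c' \<in> below_at i (c T) (\<epsilon> - T)"
    then have lt: "ray_busemann c' (factor j (embed_factor i x\<^sub>0 (c T))) < \<epsilon> - T" using iff by simp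
    have "j = i"
    proof (rule ccontr)
      assume "j \<noteq> i"
      then show False using lt i j c' T by (simp add: factor_embed_other busemann_base)
    qed
    moreover have "dist (c t) (c' t) < e" if t: "t \<in> K" for t
    proof -
      have t0: "0 \<le> t" "t \<le> T" using t K T0[OF t] by (auto simp: T_def)
      have "ray_busemann c' (c t) \<le> ray_busemann c' (c T) + dist (c t) (c T)"
        by (rule ray_busemann_lipschitz[OF raysD(1)[OF c']])
      also have "\<dots> \<le> - t + \<epsilon>"
        using lt \<open>j = i\<close> geodesic_raysD[OF raysD(1)[OF c] t0(1) T(1)] t0 by simp
      finally have "cosh (dist (c t) (c' t)) \<le> exp \<epsilon>"
        using c c' \<epsilon> t0 by (intro cosh_dist_rays_le) (auto simp: raysD)
      then have "cosh (dist (c t) (c' t)) < cosh e" using \<epsilon> by simp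
      then show ?thesis using K by (simp add: cosh_real_nonneg_less_iff)
    qed
    ultimately show "j = i \<and> endpoint c' \<in> U" using U' c' by blast
  qed
qed

lemma homeomorphic_map_phi_sing:
  "homeomorphic_map (subtopology Cstar (max_boundary_sing x\<^sub>0))
     (sum_topology (\<lambda>_. ideal_boundary_topology x\<^sub>0) {1, 2}) (phi_sing x\<^sub>0)"
proof (rule bijective_open_imp_homeomorphic_map)
  let ?S = "subtopology Cstar (max_boundary_sing x\<^sub>0)"
  let ?B = "sum_topology (\<lambda>_. ideal_boundary_topology x\<^sub>0) {1, 2::nat}"
  have top: "topspace ?S = max_boundary_sing x\<^sub>0"
    using max_boundary_sing_subset by auto
  have topB: "topspace ?B = {1, 2} \<times> ideal_boundary"
    by (simp add: topspace_ideal_boundary)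
  have image: "phi_sing x\<^sub>0 ` {factor_class i c | i c. i \<in> {1, 2} \<and> c \<in> rays \<and> Q i c}
      = {(i, endpoint c) | i c. i \<in> {1, 2} \<and> c \<in> rays \<and> Q i c}" for Q
  proof -
    have "phi_sing x\<^sub>0 ` {factor_class i c | i c. i \<in> {1, 2} \<and> c \<in> rays \<and> Q i c}
      = {phi_sing x\<^sub>0 (factor_class i c) | i c. i \<in> {1, 2} \<and> c \<in> rays \<and> Q i c}" by blast
    also have "\<dots> = {(i, endpoint c) | i c. i \<in> {1, 2} \<and> c \<in> rays \<and> Q i c}"
      using phi_sing_factor_class by (intro Collect_cong) metis
    finally show ?thesis .
  qed
  show im: "phi_sing x\<^sub>0 ` topspace ?S = topspace ?B"
    unfolding top topB unfolding max_boundary_sing_eq ideal_boundary_eq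
    using image[of "\<lambda>_ _. True"] by auto
  show "inj_on (phi_sing x\<^sub>0) (topspace ?S)"
    unfolding top unfolding max_boundary_sing_eq
  proof (rule inj_onI, elim CollectE exE conjE)
    fix P Q i j c d
    assume "phi_sing x\<^sub>0 P = phi_sing x\<^sub>0 Q" "P = factor_class i c" "Q = factor_class j d"
      "i \<in> {1, 2}" "c \<in> rays" "j \<in> {1, 2}" "d \<in> rays"
    then show "P = Q" using endpoint_inj[of c d] by (simp only: phi_sing_factor_class prod.inject)
  qed
  show "continuous_map ?S ?B (phi_sing x\<^sub>0)"
    unfolding continuous_map_def
  proof (intro conjI allI impI)
    show "phi_sing x\<^sub>0 \<in> topspace ?S \<rightarrow> topspace ?B" using im by blast
    fix W assume "openin ?B W"
    then have W: "openin (ideal_boundary_topology x\<^sub>0) {\<xi>. (i, \<xi>) \<in> W}" if "i \<in> {1, 2}" for i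
      using that unfolding openin_sum_topology by blast
    show "openin ?S {P \<in> topspace ?S. phi_sing x\<^sub>0 P \<in> W}"
    proof (subst openin_subopen, intro ballI)
      fix P assume "P \<in> {P \<in> topspace ?S. phi_sing x\<^sub>0 P \<in> W}"
      then obtain i c where P: "P = factor_class i c" and i: "i \<in> {1, 2}" and c: "c \<in> rays"
        and "phi_sing x\<^sub>0 P \<in> W" unfolding top unfolding max_boundary_sing_eq by blast
      then have "endpoint c \<in> {\<xi>. (i, \<xi>) \<in> W}" by (simp add: phi_sing_factor_class)
      from factor_class_nhd[OF c i W[OF i] this] obtain V where V: "openin Cstar V" "P \<in> V"
        "\<And>j c'. j \<in> {1, 2} \<Longrightarrow> c' \<in> rays \<Longrightarrow> factor_class j c' \<in> V \<Longrightarrow> j = i \<and> (i, endpoint c') \<in> W"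
        unfolding P by (metis mem_Collect_eq)
      have "V \<inter> max_boundary_sing x\<^sub>0 \<subseteq> {P \<in> topspace ?S. phi_sing x\<^sub>0 P \<in> W}"
      proof
        fix Q assume Q: "Q \<in> V \<inter> max_boundary_sing x\<^sub>0"
        then obtain j d where jd: "Q = factor_class j d" "j \<in> {1, 2}" "d \<in> rays"
          unfolding max_boundary_sing_eq by blast
        then have "phi_sing x\<^sub>0 Q \<in> W" using V(3)[OF jd(2,3)] Q phi_sing_factor_class[OF jd(3,2)] by auto
        then show "Q \<in> {P \<in> topspace ?S. phi_sing x\<^sub>0 P \<in> W}" using Q unfolding top by blast
      qed
      moreover have "P \<in> max_boundary_sing x\<^sub>0" unfolding P max_boundary_sing_eq using i c by blast
      moreover have "openin ?S (V \<inter> max_boundary_sing x\<^sub>0)"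
        unfolding openin_subtopology using V(1) by blast
      ultimately show "\<exists>T. openin ?S T \<and> P \<in> T \<and> T \<subseteq> {P \<in> topspace ?S. phi_sing x\<^sub>0 P \<in> W}"
        using V(2) by (intro exI[of _ "V \<inter> max_boundary_sing x\<^sub>0"]) simp
    qed
  qed
  show "open_map ?S ?B (phi_sing x\<^sub>0)"
    unfolding open_map_def
  proof (intro allI impI)
    fix U assume "openin ?S U"
    then obtain V where V: "openin Cstar V" "U = V \<inter> max_boundary_sing x\<^sub>0"
      unfolding openin_subtopology by blast
    have "U = {factor_class i c | i c. i \<in> {1, 2} \<and> c \<in> rays \<and> factor_class i c \<in> V}"
      unfolding V(2) max_boundary_sing_eq by blast
    then have "phi_sing x\<^sub>0 ` U = Sigma {1, 2} (\<lambda>i. {endpoint c | c. c \<in> rays \<and> factor_class i c \<in> V})"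
      using image[of "\<lambda>i c. factor_class i c \<in> V"] by auto
    then show "openin ?B (phi_sing x\<^sub>0 ` U)"
      using open_endpoints_factor_class[OF V(1)] by (simp add: openin_disjoint_union)
  qed
qed

end

theorem proposition2:
  fixes x\<^sub>0 :: "'a::metric_space"
  assumes "proper_space TYPE('a)"
    and "\<not> compact (UNIV :: 'a set)"
    and "CAT_neg1_space TYPE('a)"
  shows "(\<forall>\<xi>\<in>ideal_boundary.
            phi_sing x\<^sub>0 (mod_const_class (\<lambda>(z, z'). busemann x\<^sub>0 \<xi> z)) = (1, \<xi>)) \<and>
         (\<forall>\<xi>'\<in>ideal_boundary.
            phi_sing x\<^sub>0 (mod_const_class (\<lambda>(z, z'). busemann x\<^sub>0 \<xi>' z')) = (2, \<xi>')) \<and>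
         homeomorphic_map
           (subtopology Cstar (max_boundary_sing x\<^sub>0))
           (sum_topology (\<lambda>_. ideal_boundary_topology x\<^sub>0) {1, 2})
           (phi_sing x\<^sub>0)"
proof -
  interpret proper_CAT_neg1 x\<^sub>0
    by unfold_locales (use assms in auto)
  have "phi_sing x\<^sub>0 (mod_const_class (\<lambda>(z, z'). busemann x\<^sub>0 \<xi> z)) = (1, \<xi>)"
       "phi_sing x\<^sub>0 (mod_const_class (\<lambda>(z, z'). busemann x\<^sub>0 \<xi> z')) = (2, \<xi>)"
    if \<xi>: "\<xi> \<in> ideal_boundary" for \<xi>
  proof -
    obtain c where c: "c \<in> rays" "\<xi> = endpoint c" using ideal_boundaryE[OF \<xi>] .
    show "phi_sing x\<^sub>0 (mod_const_class (\<lambda>(z, z'). busemann x\<^sub>0 \<xi> z)) = (1, \<xi>)"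
      using phi_sing_factor_class[OF c(1), of 1] c
      by (simp only: busemann_fst factor_class_def) simp
    show "phi_sing x\<^sub>0 (mod_const_class (\<lambda>(z, z'). busemann x\<^sub>0 \<xi> z')) = (2, \<xi>)"
      using phi_sing_factor_class[OF c(1), of 2] c
      by (simp only: busemann_snd factor_class_def) simp
  qed
  with homeomorphic_map_phi_sing show ?thesis by blast
qed

end
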